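(* Let $\mathbf{F}_n(k)$ be the free algebra in $\mathsf{Pa}_n$ on the finite set $\{x_1,\dots,x_k\}$ of free generators. Then the following hold. (1) $\mathrm{Cm}\,\mathbf{F}_n(k)=\{\mu^L_{\mathcal{T}} : \mathcal{T}\subseteq \mathscr{P}(k),\ 0<|\mathcal{T}|\leq n,\ L\subseteq\bigcap\mathcal{T}\}$. (2) $\mu^L_{\mathcal{T}}\leq^{\mathbf{Cm}}\mu^K_{\mathcal{S}}$ if and only if $\mathcal{S}\subseteq\mathcal{T}$ and $L\subseteq K$. (3) $\mathbf{F}_n(k)\cong \mathrm{Up}(\mathcal{F}_p(\mathbf{F}_n(k)),\subseteq)\cong\mathrm{Up}(\mathrm{Cm}\,\mathbf{F}_n(k),\leq^{\mathbf{Cm}})\cong\mathrm{Up}(\mathcal{J}(\mathbf{F}_n(k)),\geq)$.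
   Context: A (distributive) p-algebra is a bounded distributive lattice $(A;\wedge,\vee,0,1)$ with a unary operation ${}^*$ satisfying $x\wedge y=0\iff x\leq y^*$. $\mathsf{Pa}$ is the variety of p-algebras. For a Boolean algebra $\mathbf{B}$ with bottom $0$, top $e$ and complement $\neg$, $\overline{\mathbf{B}}$ is the p-algebra with universe $B\uplus\{1\}$, where $1$ is a new top element above all of $B$, with $0^*=1$, $1^*=0$ and $x^*=\neg x$ for $x\in B\setminus\{0\}$. For $n\in\mathbb{N}$ (with $0\in\mathbb{N}$), $\overline{\mathbf{B}}_n$ denotes $\overline{\mathbf{B}}$ for $\mathbf{B}=\mathbf{2}^n$, the Boolean algebra with $n$ atoms (so $\overline{\mathbf{B}}_0$ is the two-element Boolean algebra $\mathbf{2}$), and $\mathsf{Pa}_n$ is the variety generated by $\overline{\mathbf{B}}_n$. $\mathscr{P}(k)$ is the power set of $\{1,\dots,k\}$. For $T\in\mathscr{P}(k)$ let $f_T(x_i)=1$ if $i\in T$ and $f_T(x_i)=0$ if $i\notin T$. For $\mathcal{T}=\{T_1,\dots,T_s\}\subseteq\mathscr{P}(k)$ with $0<s=|\mathcal{T}|\leq n$ and $L\subseteq\bigcap\mathcal{T}$, let $g^L_{\mathcal{T}}\colon\{x_1,\dots,x_k\}\to\overline{\mathbf{B}}_s$ (with Boolean part $\mathbf{2}^s$) be given by $g^L_{\mathcal{T}}(x_i)=1$ (the new top) if $i\in L$, and $g^L_{\mathcal{T}}(x_i)=(f_{T_1}(x_i),\dots,f_{T_s}(x_i))\in \mathbf{2}^s$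 if $i\notin L$. Then $\mu^L_{\mathcal{T}}$ is the kernel of the homomorphism $\mathbf{F}_n(k)\to\overline{\mathbf{B}}_s$ extending $g^L_{\mathcal{T}}$. In (2), $\mu^L_{\mathcal{T}}$ and $\mu^K_{\mathcal{S}}$ are any congruences of this form. For a p-algebra $\mathbf{A}$: $\mathrm{Cm}\,\mathbf{A}$ is the set of completely meet-irreducible congruences (those distinct from the full congruence that are not the intersection of all strictly larger congruences); for $\mu,\nu\in\mathrm{Cm}\,\mathbf{A}$, $\mu\leq^{\mathbf{Cm}}\nu$ means $1/\mu\subseteq 1/\nu$, where $1/\mu$ is the $\mu$-class of $1$; $\mathcal{F}_p(\mathbf{A})$ is the set of prime (proper) filters of $\mathbf{A}$; $\mathcal{J}(\mathbf{A})$ is the set of (nonzero) join-irreducible elements, and $(\mathcal{J}(\mathbf{A}),\geq)$ carries the reverse of the order of $\mathbf{A}$. For a poset $P$, $\mathrm{Up}(P)$ is the p-algebra of upsets of $P$ with $\cup,\cap,\emptyset,P$ and $U^*=P\setminus{\downarrow}U$; the isomorphisms in (3) are of p-algebras.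
   Formalization: Part (1) is stated for n ≥ 1 only: for n = 0 no family satisfies 0 < |T| ≤ n, while F_0(k), a nontrivial free Boolean algebra, has completely meet-irreducible congruences, so (1) fails there; (2) and (3) are for all n. *)

theory Defs
  imports Main "HOL-Library.FuncSet"
begin

section \<open>Algebras in the signature of p-algebras\<close>

record 'a palg =
  pcarrier :: "'a set"
  pmeet :: "'a \<Rightarrow> 'a \<Rightarrow> 'a"
  pjoin :: "'a \<Rightarrow> 'a \<Rightarrow> 'a"
  pzero :: 'a
  pone :: 'a
  pstar :: "'a \<Rightarrow> 'a"

definition ple :: "'a palg \<Rightarrow> 'a \<Rightarrow> 'a \<Rightarrow> bool" where
  "ple A x y \<longleftrightarrow> pmeet A x y = x"

definition p_algebra :: "'a palg \<Rightarrow> bool" where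
  "p_algebra A \<longleftrightarrow>
    pzero A \<in> pcarrier A \<and> pone A \<in> pcarrier A \<and>
    (\<forall>x\<in>pcarrier A. pstar A x \<in> pcarrier A) \<and>
    (\<forall>x\<in>pcarrier A. \<forall>y\<in>pcarrier A.
       pmeet A x y \<in> pcarrier A \<and> pjoin A x y \<in> pcarrier A \<and>
       pmeet A x y = pmeet A y x \<and> pjoin A x y = pjoin A y x \<and>
       pmeet A x (pjoin A x y) = x \<and> pjoin A x (pmeet A x y) = x) \<and>
    (\<forall>x\<in>pcarrier A. \<forall>y\<in>pcarrier A. \<forall>z\<in>pcarrier A.
       pmeet A (pmeet A x y) z = pmeet A x (pmeet A y z) \<and>
       pjoin A (pjoin A x y) z = pjoin A x (pjoin A y z) \<and>
       pmeet A x (pjoin A y z) = pjoin A (pmeet A x y) (pmeet A x z)) \<and>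
    (\<forall>x\<in>pcarrier A. ple A (pzero A) x \<and> ple A x (pone A)) \<and>
    (\<forall>x\<in>pcarrier A. \<forall>y\<in>pcarrier A.
       pmeet A x y = pzero A \<longleftrightarrow> ple A x (pstar A y))"

definition phom :: "'a palg \<Rightarrow> 'b palg \<Rightarrow> ('a \<Rightarrow> 'b) set" where
  "phom A B = {h \<in> pcarrier A \<rightarrow> pcarrier B.
     h (pzero A) = pzero B \<and> h (pone A) = pone B \<and>
     (\<forall>x\<in>pcarrier A. h (pstar A x) = pstar B (h x)) \<and>
     (\<forall>x\<in>pcarrier A. \<forall>y\<in>pcarrier A.
        h (pmeet A x y) = pmeet B (h x) (h y) \<and> h (pjoin A x y) = pjoin B (h x) (h y))}"

definition piso :: "'a palg \<Rightarrow> 'b palg \<Rightarrow> bool" where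
  "piso A B \<longleftrightarrow> (\<exists>h\<in>phom A B. bij_betw h (pcarrier A) (pcarrier B))"

definition Con :: "'a palg \<Rightarrow> ('a \<times> 'a) set set" where
  "Con A = {\<theta>. equiv (pcarrier A) \<theta> \<and>
     (\<forall>(x, x')\<in>\<theta>. (pstar A x, pstar A x') \<in> \<theta>) \<and>
     (\<forall>(x, x')\<in>\<theta>. \<forall>(y, y')\<in>\<theta>.
        (pmeet A x y, pmeet A x' y') \<in> \<theta> \<and> (pjoin A x y, pjoin A x' y') \<in> \<theta>)}"

definition Cm :: "'a palg \<Rightarrow> ('a \<times> 'a) set set" where
  "Cm A = {\<mu> \<in> Con A. \<mu> \<noteq> pcarrier A \<times> pcarrier A \<and> \<mu> \<noteq> \<Inter>{\<theta> \<in> Con A. \<mu> \<subset> \<theta>}}"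

definition le_Cm :: "'a palg \<Rightarrow> ('a \<times> 'a) set \<Rightarrow> ('a \<times> 'a) set \<Rightarrow> bool" where
  "le_Cm A \<mu> \<nu> \<longleftrightarrow> \<mu> `` {pone A} \<subseteq> \<nu> `` {pone A}"

definition quot_palg :: "'a palg \<Rightarrow> ('a \<times> 'a) set \<Rightarrow> 'a set palg" where
  "quot_palg A \<theta> =
    \<lparr>pcarrier = pcarrier A // \<theta>,
     pmeet = (\<lambda>X Y. \<Union>x\<in>X. \<Union>y\<in>Y. \<theta> `` {pmeet A x y}),
     pjoin = (\<lambda>X Y. \<Union>x\<in>X. \<Union>y\<in>Y. \<theta> `` {pjoin A x y}),
     pzero = \<theta> `` {pzero A},
     pone = \<theta> `` {pone A},
     pstar = (\<lambda>X. \<Union>x\<in>X. \<theta> `` {pstar A x})\<rparr>"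

definition prime_filters :: "'a palg \<Rightarrow> 'a set set" where
  "prime_filters A = {P. P \<subseteq> pcarrier A \<and> P \<noteq> {} \<and> P \<noteq> pcarrier A \<and>
     (\<forall>x\<in>P. \<forall>y\<in>pcarrier A. ple A x y \<longrightarrow> y \<in> P) \<and>
     (\<forall>x\<in>P. \<forall>y\<in>P. pmeet A x y \<in> P) \<and>
     (\<forall>x\<in>pcarrier A. \<forall>y\<in>pcarrier A. pjoin A x y \<in> P \<longrightarrow> x \<in> P \<or> y \<in> P)}"

definition join_irreducibles :: "'a palg \<Rightarrow> 'a set" where
  "join_irreducibles A = {x \<in> pcarrier A. x \<noteq> pzero A \<and>
     (\<forall>a\<in>pcarrier A. \<forall>b\<in>pcarrier A. x = pjoin A a b \<longrightarrow> x = a \<or> x = b)}"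

text \<open>The p-algebra of upsets of the poset with universe \<open>P\<close> and order \<open>le\<close>.\<close>

definition Up :: "'p set \<Rightarrow> ('p \<Rightarrow> 'p \<Rightarrow> bool) \<Rightarrow> 'p set palg" where
  "Up P le =
    \<lparr>pcarrier = {U. U \<subseteq> P \<and> (\<forall>u\<in>U. \<forall>v\<in>P. le u v \<longrightarrow> v \<in> U)},
     pmeet = (\<inter>), pjoin = (\<union>), pzero = {}, pone = P,
     pstar = (\<lambda>U. P - {p \<in> P. \<exists>u\<in>U. le p u})\<rparr>"


section \<open>The algebras generating the varieties\<close>

text \<open>A Boolean algebra is given in the same signature, with complement as \<open>pstar\<close>.
  In \<open>add_top B\<close> the new top element is \<open>None\<close>.\<close>

definition add_top :: "'b palg \<Rightarrow> 'b option palg" where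
  "add_top B =
    \<lparr>pcarrier = insert None (Some ` pcarrier B),
     pmeet = (\<lambda>x y. case x of None \<Rightarrow> y | Some a \<Rightarrow>
                (case y of None \<Rightarrow> x | Some b \<Rightarrow> Some (pmeet B a b))),
     pjoin = (\<lambda>x y. case x of None \<Rightarrow> None | Some a \<Rightarrow>
                (case y of None \<Rightarrow> None | Some b \<Rightarrow> Some (pjoin B a b))),
     pzero = Some (pzero B),
     pone = None,
     pstar = (\<lambda>x. case x of None \<Rightarrow> Some (pzero B) | Some a \<Rightarrow>
                (if a = pzero B then None else Some (pstar B a)))\<rparr>"

text \<open>A tuple in \<open>2\<^sup>n\<close> is represented by the set of the coordinates \<open>j < n\<close> at which it
  equals 1.\<close>

definition two_pow :: "nat \<Rightarrow> nat set palg" where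
  "two_pow n =
    \<lparr>pcarrier = Pow {..<n}, pmeet = (\<inter>), pjoin = (\<union>), pzero = {}, pone = {..<n},
     pstar = (\<lambda>X. {..<n} - X)\<rparr>"

definition Bbar :: "nat \<Rightarrow> nat set option palg" where
  "Bbar n = add_top (two_pow n)"


section \<open>Identities, generated varieties and free algebras\<close>

datatype pterm =
  Var nat | Zero | One | Star pterm | Meet pterm pterm | Join pterm pterm

fun pvars :: "pterm \<Rightarrow> nat set" where
  "pvars (Var i) = {i}"
| "pvars Zero = {}"
| "pvars One = {}"
| "pvars (Star s) = pvars s"
| "pvars (Meet s t) = pvars s \<union> pvars t"
| "pvars (Join s t) = pvars s \<union> pvars t"

fun peval :: "'a palg \<Rightarrow> (nat \<Rightarrow> 'a) \<Rightarrow> pterm \<Rightarrow> 'a" where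
  "peval A v (Var i) = v i"
| "peval A v Zero = pzero A"
| "peval A v One = pone A"
| "peval A v (Star s) = pstar A (peval A v s)"
| "peval A v (Meet s t) = pmeet A (peval A v s) (peval A v t)"
| "peval A v (Join s t) = pjoin A (peval A v s) (peval A v t)"

definition satisfies :: "'a palg \<Rightarrow> pterm \<Rightarrow> pterm \<Rightarrow> bool" where
  "satisfies A s t \<longleftrightarrow> (\<forall>v\<in>UNIV \<rightarrow> pcarrier A. peval A v s = peval A v t)"

text \<open>Membership in the variety generated by \<open>Bbar n\<close>: the class of the (p-)algebras that
  satisfy all identities of \<open>Bbar n\<close>. This predicate is polymorphic in the type of the
  elements of \<open>A\<close>.\<close>

definition Pa :: "nat \<Rightarrow> 'a palg \<Rightarrow> bool" where
  "Pa n A \<longleftrightarrow> p_algebra A \<and> (\<forall>s t. satisfies (Bbar n) s t \<longrightarrow> satisfies A s t)"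

definition term_palg :: "nat \<Rightarrow> pterm palg" where
  "term_palg k =
    \<lparr>pcarrier = {t. pvars t \<subseteq> {1..k}}, pmeet = Meet, pjoin = Join, pzero = Zero,
     pone = One, pstar = Star\<rparr>"

text \<open>The free algebra is the algebra of terms in \<open>x\<^sub>1, \<dots>, x\<^sub>k\<close> modulo the identities of the
  variety. An identity holds throughout the variety generated by \<open>Bbar n\<close> iff it holds in
  \<open>Bbar n\<close>. That this algebra is in the variety and has the universal property is proved in
  \<open>Pa_free\<close> and \<open>free_universal\<close>.\<close>

definition term_equiv :: "nat \<Rightarrow> nat \<Rightarrow> (pterm \<times> pterm) set" where
  "term_equiv n k =
    {(s, t). pvars s \<subseteq> {1..k} \<and> pvars t \<subseteq> {1..k} \<and> satisfies (Bbar n) s t}"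

definition free :: "nat \<Rightarrow> nat \<Rightarrow> pterm set palg" where
  "free n k = quot_palg (term_palg k) (term_equiv n k)"

definition gen :: "nat \<Rightarrow> nat \<Rightarrow> nat \<Rightarrow> pterm set" where
  "gen n k i = term_equiv n k `` {Var i}"

definition free_ext :: "nat \<Rightarrow> nat \<Rightarrow> 'a palg \<Rightarrow> (nat \<Rightarrow> 'a) \<Rightarrow> pterm set \<Rightarrow> 'a" where
  "free_ext n k A g =
    (THE h. h \<in> phom (free n k) A \<and> h \<in> extensional (pcarrier (free n k)) \<and>
       (\<forall>i\<in>{1..k}. h (gen n k i) = g i))"


subsection \<open>Adequacy of the construction\<close>

lemma Bbar_simps [simp]:
  "pcarrier (Bbar n) = insert None (Some ` Pow {..<n})"
  "pzero (Bbar n) = Some {}"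
  "pone (Bbar n) = None"
  "pmeet (Bbar n) None y = y"
  "pmeet (Bbar n) x None = x"
  "pmeet (Bbar n) (Some a) (Some b) = Some (a \<inter> b)"
  "pjoin (Bbar n) None y = None"
  "pjoin (Bbar n) x None = None"
  "pjoin (Bbar n) (Some a) (Some b) = Some (a \<union> b)"
  "pstar (Bbar n) None = Some {}"
  "pstar (Bbar n) (Some a) = (if a = {} then None else Some ({..<n} - a))"
  by (auto simp: Bbar_def add_top_def two_pow_def split: option.splits)

lemma Bbar_ball:
  "(\<forall>x\<in>pcarrier (Bbar n). P x) \<longleftrightarrow> P None \<and> (\<forall>a. a \<subseteq> {..<n} \<longrightarrow> P (Some a))"
  by auto

lemma Some_in_Bbar: "Some a \<in> pcarrier (Bbar n) \<longleftrightarrow> a \<subseteq> {..<n}" "None \<in> pcarrier (Bbar n)"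
  by auto

lemma p_algebra_Bbar: "p_algebra (Bbar n)"
  unfolding p_algebra_def ple_def Bbar_ball
  by (auto simp: Some_in_Bbar simp del: Bbar_simps(1))

lemma p_algebra_closed:
  assumes "p_algebra A"
  shows "pzero A \<in> pcarrier A" "pone A \<in> pcarrier A"
    "x \<in> pcarrier A \<Longrightarrow> pstar A x \<in> pcarrier A"
    "x \<in> pcarrier A \<Longrightarrow> y \<in> pcarrier A \<Longrightarrow> pmeet A x y \<in> pcarrier A"
    "x \<in> pcarrier A \<Longrightarrow> y \<in> pcarrier A \<Longrightarrow> pjoin A x y \<in> pcarrier A"
  using assms unfolding p_algebra_def by blast+

lemma peval_closed:
  assumes "p_algebra A" "v \<in> UNIV \<rightarrow> pcarrier A"
  shows "peval A v t \<in> pcarrier A"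
  using assms(2) by (induction t) (auto simp: p_algebra_closed[OF assms(1)])

lemma peval_hom:
  assumes h: "h \<in> phom A B" and A: "p_algebra A" and v: "v \<in> UNIV \<rightarrow> pcarrier A"
  shows "h (peval A v t) = peval B (h \<circ> v) t"
  using h by (induction t) (auto simp: phom_def peval_closed[OF A v])

lemma peval_cong: "(\<And>i. i \<in> pvars t \<Longrightarrow> v i = w i) \<Longrightarrow> peval A v t = peval A w t"
  by (induction t) auto

lemma Pa_Bbar:
  assumes "s \<le> n"
  shows "Pa n (Bbar s)"
  unfolding Pa_def
proof (intro conjI allI impI p_algebra_Bbar)
  fix t u assume sat: "satisfies (Bbar n) t u"
  define r where "r j = (if j < s then j else 0)" for j :: nat
  define p where "p X = {j. j < n \<and> r j \<in> X}" for X
  have p_mono: "X \<subseteq> Y" if "X \<subseteq> {..<s}" "p X \<subseteq> p Y" for X Y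
  proof
    fix j assume "j \<in> X"
    with that(1) assms have "j < s" "j < n" by auto
    then have "j \<in> p X" using \<open>j \<in> X\<close> by (simp add: r_def p_def)
    then show "j \<in> Y" using that(2) \<open>j < s\<close> by (auto simp: r_def p_def)
  qed
  have p0: "p {} = {}" by (simp add: p_def)
  have p1: "p X = {} \<longleftrightarrow> X = {}" if "X \<subseteq> {..<s}" for X
    using p_mono[OF that, of "{}"] p0 by auto
  have p2: "p ({..<s} - X) = {..<n} - p X" if "X \<subseteq> {..<s}" "X \<noteq> {}" for X
    using that by (auto simp: r_def p_def)
  have p3: "p X \<subseteq> {..<n}" "p (X \<inter> Y) = p X \<inter> p Y" "p (X \<union> Y) = p X \<union> p Y" for X Y
    by (auto simp: p_def)
  define h where "h = map_option p"
  have hom: "h \<in> phom (Bbar s) (Bbar n)"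
    unfolding phom_def h_def mem_Collect_eq Pi_iff Bbar_ball
    by (simp add: Some_in_Bbar p0 p1 p2 p3 del: Bbar_simps(1))
  have inj: "inj_on h (pcarrier (Bbar s))"
  proof -
    have "X = Y" if "X \<subseteq> {..<s}" "Y \<subseteq> {..<s}" "p X = p Y" for X Y
      using p_mono[of X Y] p_mono[of Y X] that by (simp add: subset_antisym)
    then show ?thesis unfolding inj_on_def Bbar_ball h_def by simp
  qed
  show "satisfies (Bbar s) t u"
    unfolding satisfies_def
  proof
    fix v :: "nat \<Rightarrow> nat set option" assume v: "v \<in> UNIV \<rightarrow> pcarrier (Bbar s)"
    have "h \<circ> v \<in> UNIV \<rightarrow> pcarrier (Bbar n)"
      using v hom unfolding phom_def Pi_iff mem_Collect_eq comp_def by blast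
    then have "h (peval (Bbar s) v t) = h (peval (Bbar s) v u)"
      using sat unfolding peval_hom[OF hom p_algebra_Bbar v] satisfies_def by blast
    then show "peval (Bbar s) v t = peval (Bbar s) v u"
      using inj peval_closed[OF p_algebra_Bbar v] by (meson inj_onD)
  qed
qed

lemma term_equiv_equiv: "equiv (pcarrier (term_palg k)) (term_equiv n k)"
  by (auto simp: equiv_def refl_on_def sym_on_def trans_on_def term_equiv_def term_palg_def
      satisfies_def)

lemma term_equiv_class_eq:
  assumes "pvars s \<subseteq> {1..k}" "pvars t \<subseteq> {1..k}"
  shows "term_equiv n k `` {s} = term_equiv n k `` {t} \<longleftrightarrow> satisfies (Bbar n) s t"
  using eq_equiv_class_iff[OF term_equiv_equiv] assms
  by (auto simp: term_palg_def term_equiv_def)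

lemma free_carrier:
  "pcarrier (free n k) = {term_equiv n k `` {t} | t. pvars t \<subseteq> {1..k}}"
  by (auto simp: free_def quot_palg_def quotient_def term_palg_def)

lemma free_const:
  "pzero (free n k) = term_equiv n k `` {Zero}" "pone (free n k) = term_equiv n k `` {One}"
  by (auto simp: free_def quot_palg_def term_palg_def)

lemma free_star:
  assumes "pvars s \<subseteq> {1..k}"
  shows "pstar (free n k) (term_equiv n k `` {s}) = term_equiv n k `` {Star s}"
proof -
  have "(\<lambda>x. term_equiv n k `` {Star x}) respects term_equiv n k"
    unfolding congruent_def using term_equiv_class_eq
    by (auto simp: term_equiv_def satisfies_def)
  then show ?thesis
    using UN_equiv_class[OF term_equiv_equiv, of n k "\<lambda>x. term_equiv n k `` {Star x}" s] assms
    by (simp add: free_def quot_palg_def term_palg_def)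
qed

lemma free_binary:
  assumes "pvars s \<subseteq> {1..k}" "pvars t \<subseteq> {1..k}"
  shows "pmeet (free n k) (term_equiv n k `` {s}) (term_equiv n k `` {t}) =
      term_equiv n k `` {Meet s t}"
    "pjoin (free n k) (term_equiv n k `` {s}) (term_equiv n k `` {t}) =
      term_equiv n k `` {Join s t}"
proof -
  have "(\<lambda>x y. term_equiv n k `` {Meet x y}) respects2 term_equiv n k"
    unfolding congruent2_def using term_equiv_class_eq
    by (auto simp: term_equiv_def satisfies_def)
  from UN_equiv_class2[OF term_equiv_equiv term_equiv_equiv this]
  show "pmeet (free n k) (term_equiv n k `` {s}) (term_equiv n k `` {t}) =
      term_equiv n k `` {Meet s t}"
    using assms by (simp add: free_def quot_palg_def term_palg_def)
  have "(\<lambda>x y. term_equiv n k `` {Join x y}) respects2 term_equiv n k"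
    unfolding congruent2_def using term_equiv_class_eq
    by (auto simp: term_equiv_def satisfies_def)
  from UN_equiv_class2[OF term_equiv_equiv term_equiv_equiv this]
  show "pjoin (free n k) (term_equiv n k `` {s}) (term_equiv n k `` {t}) =
      term_equiv n k `` {Join s t}"
    using assms by (simp add: free_def quot_palg_def term_palg_def)
qed

lemma p_algebra_laws:
  assumes "p_algebra A" "x \<in> pcarrier A" "y \<in> pcarrier A" "z \<in> pcarrier A"
  shows "pmeet A x y = pmeet A y x" "pjoin A x y = pjoin A y x"
    "pmeet A x (pjoin A x y) = x" "pjoin A x (pmeet A x y) = x"
    "pmeet A (pmeet A x y) z = pmeet A x (pmeet A y z)"
    "pjoin A (pjoin A x y) z = pjoin A x (pjoin A y z)"
    "pmeet A x (pjoin A y z) = pjoin A (pmeet A x y) (pmeet A x z)"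
    "pmeet A (pzero A) x = pzero A" "pmeet A x (pone A) = x"
    "pmeet A x y = pzero A \<longleftrightarrow> pmeet A x (pstar A y) = x"
  using assms unfolding p_algebra_def ple_def by blast+

lemma p_algebra_free: "p_algebra (free n k)"
proof -
  note laws = p_algebra_laws[OF p_algebra_Bbar peval_closed[OF p_algebra_Bbar]
      peval_closed[OF p_algebra_Bbar] peval_closed[OF p_algebra_Bbar]]
  have all: "(\<forall>x\<in>pcarrier (free n k). P x) \<longleftrightarrow>
      (\<forall>s. pvars s \<subseteq> {1..k} \<longrightarrow> P (term_equiv n k `` {s}))" for P
    unfolding free_carrier by blast
  have mem: "pvars s \<subseteq> {1..k} \<Longrightarrow> term_equiv n k `` {s} \<in> pcarrier (free n k)" for s
    unfolding free_carrier by blast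
  show ?thesis
    unfolding p_algebra_def ple_def all
    by (intro conjI allI impI;
        simp only: free_const free_star free_binary mem term_equiv_class_eq satisfies_def
          peval.simps pvars.simps Un_least empty_subsetI;
        (intro ballI ball_cong refl, rule laws; assumption)?)
qed

lemma peval_free:
  assumes "\<And>i. pvars (\<sigma> i) \<subseteq> {1..k}"
  shows "\<exists>t'. pvars t' \<subseteq> {1..k} \<and>
    peval (free n k) (\<lambda>i. term_equiv n k `` {\<sigma> i}) t = term_equiv n k `` {t'} \<and>
    (\<forall>v. peval (Bbar n) v t' = peval (Bbar n) (\<lambda>i. peval (Bbar n) v (\<sigma> i)) t)"
proof (induction t)
  case (Var i)
  then show ?case using assms by auto
next
  case Zero
  then show ?case by (intro exI[of _ Zero]) (simp add: free_const)
next
  case One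
  then show ?case by (intro exI[of _ One]) (simp add: free_const)
next
  case (Star t)
  then obtain t' where "pvars t' \<subseteq> {1..k}"
    "peval (free n k) (\<lambda>i. term_equiv n k `` {\<sigma> i}) t = term_equiv n k `` {t'}"
    "\<forall>v. peval (Bbar n) v t' = peval (Bbar n) (\<lambda>i. peval (Bbar n) v (\<sigma> i)) t" by blast
  then show ?case by (intro exI[of _ "Star t'"]) (simp add: free_star)
next
  case (Meet t u)
  then obtain t' u' where "pvars t' \<subseteq> {1..k}" "pvars u' \<subseteq> {1..k}"
    "peval (free n k) (\<lambda>i. term_equiv n k `` {\<sigma> i}) t = term_equiv n k `` {t'}"
    "peval (free n k) (\<lambda>i. term_equiv n k `` {\<sigma> i}) u = term_equiv n k `` {u'}"
    "\<forall>v. peval (Bbar n) v t' = peval (Bbar n) (\<lambda>i. peval (Bbar n) v (\<sigma> i)) t"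
    "\<forall>v. peval (Bbar n) v u' = peval (Bbar n) (\<lambda>i. peval (Bbar n) v (\<sigma> i)) u" by blast
  then show ?case by (intro exI[of _ "Meet t' u'"]) (simp add: free_binary)
next
  case (Join t u)
  then obtain t' u' where "pvars t' \<subseteq> {1..k}" "pvars u' \<subseteq> {1..k}"
    "peval (free n k) (\<lambda>i. term_equiv n k `` {\<sigma> i}) t = term_equiv n k `` {t'}"
    "peval (free n k) (\<lambda>i. term_equiv n k `` {\<sigma> i}) u = term_equiv n k `` {u'}"
    "\<forall>v. peval (Bbar n) v t' = peval (Bbar n) (\<lambda>i. peval (Bbar n) v (\<sigma> i)) t"
    "\<forall>v. peval (Bbar n) v u' = peval (Bbar n) (\<lambda>i. peval (Bbar n) v (\<sigma> i)) u" by blast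
  then show ?case by (intro exI[of _ "Join t' u'"]) (simp add: free_binary)
qed

lemma Pa_free: "Pa n (free n k)"
  unfolding Pa_def
proof (intro conjI allI impI p_algebra_free)
  fix s t assume sat: "satisfies (Bbar n) s t"
  show "satisfies (free n k) s t"
    unfolding satisfies_def
  proof
    fix v :: "nat \<Rightarrow> pterm set" assume "v \<in> UNIV \<rightarrow> pcarrier (free n k)"
    then have "\<forall>i. \<exists>u. pvars u \<subseteq> {1..k} \<and> v i = term_equiv n k `` {u}"
      unfolding free_carrier by blast
    then obtain \<sigma> where \<sigma>: "\<And>i. pvars (\<sigma> i) \<subseteq> {1..k}" "\<And>i. v i = term_equiv n k `` {\<sigma> i}"
      by metis
    then have v: "v = (\<lambda>i. term_equiv n k `` {\<sigma> i})" by blast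
    obtain s' where s': "pvars s' \<subseteq> {1..k}" "peval (free n k) v s = term_equiv n k `` {s'}"
      "\<forall>w. peval (Bbar n) w s' = peval (Bbar n) (\<lambda>i. peval (Bbar n) w (\<sigma> i)) s"
      using peval_free[of \<sigma> k n s, OF \<sigma>(1)] unfolding v by blast
    obtain t' where t': "pvars t' \<subseteq> {1..k}" "peval (free n k) v t = term_equiv n k `` {t'}"
      "\<forall>w. peval (Bbar n) w t' = peval (Bbar n) (\<lambda>i. peval (Bbar n) w (\<sigma> i)) t"
      using peval_free[of \<sigma> k n t, OF \<sigma>(1)] unfolding v by blast
    have "satisfies (Bbar n) s' t'"
      unfolding satisfies_def
    proof
      fix w :: "nat \<Rightarrow> nat set option" assume "w \<in> UNIV \<rightarrow> pcarrier (Bbar n)"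
      then have "(\<lambda>i. peval (Bbar n) w (\<sigma> i)) \<in> UNIV \<rightarrow> pcarrier (Bbar n)"
        using peval_closed[OF p_algebra_Bbar] by blast
      then show "peval (Bbar n) w s' = peval (Bbar n) w t'"
        using sat s'(3) t'(3) by (auto simp: satisfies_def simp del: Bbar_simps)
    qed
    then show "peval (free n k) v s = peval (free n k) v t"
      using s' t' by (simp add: term_equiv_class_eq)
  qed
qed

lemma free_universal:
  assumes A: "Pa n A" and g: "g \<in> {1..k} \<rightarrow> pcarrier A"
  shows "\<exists>!h. h \<in> phom (free n k) A \<and> h \<in> extensional (pcarrier (free n k)) \<and>
    (\<forall>i\<in>{1..k}. h (gen n k i) = g i)"
proof -
  have pA: "p_algebra A" using A by (simp add: Pa_def)
  define v where "v i = (if i \<in> {1..k} then g i else pzero A)" for i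
  have v: "v \<in> UNIV \<rightarrow> pcarrier A"
    using g p_algebra_closed(1)[OF pA] by (auto simp: v_def)
  define h where "h = restrict (\<lambda>X. peval A v (SOME t. t \<in> X)) (pcarrier (free n k))"
  have h: "h (term_equiv n k `` {t}) = peval A v t" if t: "pvars t \<subseteq> {1..k}" for t
  proof -
    have "t \<in> term_equiv n k `` {t}" using t by (simp add: term_equiv_def satisfies_def)
    then have "(SOME u. u \<in> term_equiv n k `` {t}) \<in> term_equiv n k `` {t}" by (rule someI)
    then have "satisfies A t (SOME u. u \<in> term_equiv n k `` {t})"
      using A unfolding term_equiv_def Pa_def by blast
    then have "peval A v t = peval A v (SOME u. u \<in> term_equiv n k `` {t})"
      using v unfolding satisfies_def by blast
    moreover have "term_equiv n k `` {t} \<in> pcarrier (free n k)"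
      unfolding free_carrier using t by blast
    ultimately show ?thesis by (simp add: h_def)
  qed
  show ?thesis
  proof (rule ex1I[of _ h], intro conjI ballI)
    show "h \<in> phom (free n k) A"
      unfolding phom_def
      by (auto simp: free_carrier free_const free_star free_binary h peval_closed[OF pA v])
    show "h \<in> extensional (pcarrier (free n k))" by (simp add: h_def)
    show "h (gen n k i) = g i" if "i \<in> {1..k}" for i
      using that by (simp add: gen_def h v_def)
  next
    fix h' assume h': "h' \<in> phom (free n k) A \<and> h' \<in> extensional (pcarrier (free n k)) \<and>
      (\<forall>i\<in>{1..k}. h' (gen n k i) = g i)"
    have mem: "pvars s \<subseteq> {1..k} \<Longrightarrow> term_equiv n k `` {s} \<in> pcarrier (free n k)" for s
      unfolding free_carrier by blast
    have "h' (term_equiv n k `` {t}) = peval A v t" if "pvars t \<subseteq> {1..k}" for t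
      using that
    proof (induction t)
      case (Var i)
      then show ?case using h' by (simp add: gen_def v_def)
    next
      case Zero
      then show ?case using h' by (simp add: phom_def free_const)
    next
      case One
      then show ?case using h' by (simp add: phom_def free_const)
    next
      case (Star t)
      then show ?case using h' mem by (simp add: phom_def flip: free_star)
    next
      case (Meet t u)
      then show ?case using h' mem by (simp add: phom_def flip: free_binary)
    next
      case (Join t u)
      then show ?case using h' mem by (simp add: phom_def flip: free_binary)
    qed
    then have "h' x = h x" if "x \<in> pcarrier (free n k)" for x
      using that h unfolding free_carrier by auto
    moreover have "h \<in> extensional (pcarrier (free n k))" by (simp add: h_def)
    ultimately show "h' = h" using h' extensionalityI by blast
  qed
qed


section \<open>The congruences \<open>\<mu>\<close>\<close>

text \<open>The set \<open>\<T>\<close> is given by an enumeration \<open>T\<^sub>1, \<dots>, T\<^sub>s\<close> without repetitions, that is, by a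
  distinct list \<open>Ts\<close>. The coordinates of \<open>2\<^sup>s\<close> are numbered \<open>0, \<dots>, s - 1\<close>.\<close>

definition admissible :: "nat \<Rightarrow> nat \<Rightarrow> nat set list \<Rightarrow> nat set \<Rightarrow> bool" where
  "admissible n k Ts L \<longleftrightarrow>
    distinct Ts \<and> set Ts \<subseteq> Pow {1..k} \<and> 0 < length Ts \<and> length Ts \<le> n \<and> L \<subseteq> \<Inter>(set Ts)"

definition g_map :: "nat set list \<Rightarrow> nat set \<Rightarrow> nat \<Rightarrow> nat set option" where
  "g_map Ts L i = (if i \<in> L then None else Some {j. j < length Ts \<and> i \<in> Ts ! j})"

lemma g_map_closed: "g_map Ts L \<in> {1..k} \<rightarrow> pcarrier (Bbar (length Ts))"
  by (auto simp: g_map_def Some_in_Bbar simp del: Bbar_simps(1))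

text \<open>By \<open>Pa_Bbar\<close>, \<open>g_map_closed\<close> and \<open>free_universal\<close>, the description in \<open>free_ext\<close>
  determines a homomorphism whenever \<open>admissible n k Ts L\<close>.\<close>

definition mu :: "nat \<Rightarrow> nat \<Rightarrow> nat set list \<Rightarrow> nat set \<Rightarrow> (pterm set \<times> pterm set) set" where
  "mu n k Ts L =
    {(a, b). a \<in> pcarrier (free n k) \<and> b \<in> pcarrier (free n k) \<and>
       free_ext n k (Bbar (length Ts)) (g_map Ts L) a =
       free_ext n k (Bbar (length Ts)) (g_map Ts L) b}"

end

theory Submission
  imports Defs
begin

text \<open>
  Everything is reduced to prime filters. In a finite p-algebra, a prime filter \<open>P\<close> determines the
  congruence \<open>prime_con P\<close>, which identifies two elements if \<open>P\<close> does not separate them and their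
  pseudocomplements agree below some element of \<open>P\<close>. Its class of \<open>1\<close> is \<open>P\<close>, and it is the largest
  congruence for which \<open>P\<close> is a union of classes (\<open>Con_le_prime_con\<close>). Two elements that are not
  identified by a congruence \<open>\<theta>\<close> are separated by a prime filter that is a union of \<open>\<theta>\<close>-classes
  (\<open>Con_separation\<close>), so \<open>\<theta>\<close> is an intersection of congruences \<open>prime_con P\<close>, and it is one of them
  if it is completely meet-irreducible. Conversely, if \<open>m\<close> is the greatest element outside \<open>P\<close>, then
  every congruence strictly above \<open>prime_con P\<close> identifies \<open>m\<close> with \<open>1\<close>. Thus the completely
  meet-irreducible congruences are exactly the \<open>prime_con P\<close> (\<open>Cm_eq\<close>), and as their order compares
  the classes of \<open>1\<close>, this is an order isomorphism with the prime filters under inclusion. The three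
  isomorphisms then follow from the duality for finite distributive lattices, where the least
  elements of the prime filters are the join-irreducible elements; only the description of the
  pseudocomplement (\<open>star_mem_prime_filter\<close>) has to be added.

  In \<open>Bbar s\<close> an element is determined by its pseudocomplement together with the information whether
  it is the top. Therefore the kernel of a homomorphism \<open>h\<close> into \<open>Bbar s\<close> is \<open>prime_con\<close> of the
  preimage of the top (\<open>kernel_eq_prime_con\<close>), and \<open>mu n k Ts L\<close> is determined by the set of terms
  that take the top as their value. This set is described by intuitionistic forcing at the root of
  a Kripke model: above the root, where the variables in \<open>L\<close> hold, there is one maximal node for each
  \<open>T\<close> in the family, where the variables in \<open>T\<close> hold (\<open>forces\<close>, \<open>peval_Bbar\<close>). In this form the
  comparison of two of the congruences is immediate: forcing persists if maximal nodes are removed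
  or \<open>L\<close> is enlarged, while variables and pseudocomplements of minterms detect any failure of the
  two inclusions (\<open>forces_le_iff\<close>).

  It remains to see that, for \<open>n \<ge> 1\<close>, every prime filter \<open>P\<close> of the free algebra is the set of terms forced at
  such a root. Let \<open>j\<close> be the least element of \<open>P\<close> and \<open>m\<close> the greatest element outside \<open>P\<close>. As \<open>j\<close>
  is not below \<open>m\<close>, some valuation in \<open>Bbar n\<close> gives \<open>j\<close> the value top, but not \<open>m\<close>
  (\<open>valuation_separates\<close>). The elements with value top form a prime filter that contains \<open>j\<close> and
  misses \<open>m\<close>, and \<open>P\<close> is the only one.
\<close>

section \<open>Arithmetic of p-algebras\<close>

locale p_alg =
  fixes A :: "'a palg"
  assumes p_algebra: "p_algebra A"
begin

abbreviation C :: "'a set" where "C \<equiv> pcarrier A"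
abbreviation meet (infixl "\<sqinter>" 70) where "x \<sqinter> y \<equiv> pmeet A x y"
abbreviation join (infixl "\<squnion>" 65) where "x \<squnion> y \<equiv> pjoin A x y"
abbreviation le (infix "\<sqsubseteq>" 50) where "x \<sqsubseteq> y \<equiv> ple A x y"
abbreviation zero ("\<zero>") where "\<zero> \<equiv> pzero A"
abbreviation one ("\<one>") where "\<one> \<equiv> pone A"
abbreviation star where "star x \<equiv> pstar A x"

lemmas closed [simp, intro] = p_algebra_closed[OF p_algebra]

lemmas laws = p_algebra_laws[OF p_algebra]

lemmas meet_comm = laws(1)[OF _ _ closed(1)]
  and join_comm = laws(2)[OF _ _ closed(1)]
  and meet_absorb = laws(3)[OF _ _ closed(1)]
  and join_absorb = laws(4)[OF _ _ closed(1)]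
  and meet_assoc = laws(5)
  and distrib = laws(7)
  and zero_meet [simp] = laws(8)[OF _ closed(1) closed(1)]
  and meet_one [simp] = laws(9)[OF _ closed(1) closed(1)]
  and star_iff = laws(10)[OF _ _ closed(1), folded ple_def]

lemma meet_idem [simp]: "x \<in> C \<Longrightarrow> x \<sqinter> x = x"
  by (metis closed(4) join_absorb meet_absorb)

lemma join_idem [simp]: "x \<in> C \<Longrightarrow> x \<squnion> x = x"
  by (metis join_absorb meet_idem)

lemma meet_left_idem [simp]: "x \<in> C \<Longrightarrow> y \<in> C \<Longrightarrow> x \<sqinter> (x \<sqinter> y) = x \<sqinter> y"
  by (metis meet_assoc meet_idem)

lemma meet_left_comm: "x \<in> C \<Longrightarrow> y \<in> C \<Longrightarrow> z \<in> C \<Longrightarrow> x \<sqinter> (y \<sqinter> z) = y \<sqinter> (x \<sqinter> z)"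
  by (metis meet_assoc meet_comm)

lemmas meet_ac = meet_assoc meet_comm meet_left_comm

lemma meet_zero [simp]: "x \<in> C \<Longrightarrow> x \<sqinter> \<zero> = \<zero>"
  by (metis closed(1) meet_comm zero_meet)

lemma one_meet [simp]: "x \<in> C \<Longrightarrow> \<one> \<sqinter> x = x"
  by (metis closed(2) meet_comm meet_one)

lemma one_join [simp]: "x \<in> C \<Longrightarrow> \<one> \<squnion> x = \<one>"
  by (metis closed(2,5) meet_absorb one_meet)

lemma le_refl [simp]: "x \<in> C \<Longrightarrow> x \<sqsubseteq> x"
  by (simp add: ple_def)

lemma le_trans: "x \<sqsubseteq> y \<Longrightarrow> y \<sqsubseteq> z \<Longrightarrow> x \<in> C \<Longrightarrow> y \<in> C \<Longrightarrow> z \<in> C \<Longrightarrow> x \<sqsubseteq> z"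
  unfolding ple_def by (metis meet_assoc)

lemma le_antisym: "x \<sqsubseteq> y \<Longrightarrow> y \<sqsubseteq> x \<Longrightarrow> x \<in> C \<Longrightarrow> y \<in> C \<Longrightarrow> x = y"
  unfolding ple_def by (metis meet_comm)

lemma zero_le [simp]: "x \<in> C \<Longrightarrow> \<zero> \<sqsubseteq> x"
  by (simp add: ple_def)

lemma le_one [simp]: "x \<in> C \<Longrightarrow> x \<sqsubseteq> \<one>"
  by (simp add: ple_def)

lemma meet_le1 [simp]: "x \<in> C \<Longrightarrow> y \<in> C \<Longrightarrow> x \<sqinter> y \<sqsubseteq> x"
  by (simp add: ple_def meet_ac)

lemma meet_le2 [simp]: "x \<in> C \<Longrightarrow> y \<in> C \<Longrightarrow> x \<sqinter> y \<sqsubseteq> y"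
  by (simp add: ple_def meet_ac)

lemma le_meet_iff:
  "x \<in> C \<Longrightarrow> y \<in> C \<Longrightarrow> z \<in> C \<Longrightarrow> z \<sqsubseteq> x \<sqinter> y \<longleftrightarrow> z \<sqsubseteq> x \<and> z \<sqsubseteq> y"
  by (metis closed(4) le_trans meet_assoc meet_le1 meet_le2 ple_def)

lemma join_ge1 [simp]: "x \<in> C \<Longrightarrow> y \<in> C \<Longrightarrow> x \<sqsubseteq> x \<squnion> y"
  by (simp add: ple_def meet_absorb)

lemma join_ge2 [simp]: "x \<in> C \<Longrightarrow> y \<in> C \<Longrightarrow> y \<sqsubseteq> x \<squnion> y"
  by (metis join_comm join_ge1)

lemma meet_star [simp]: "x \<in> C \<Longrightarrow> x \<sqinter> star x = \<zero>"
  using star_iff[of "star x" x] meet_comm[of x "star x"] by simp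

lemma star_meet [simp]: "x \<in> C \<Longrightarrow> star x \<sqinter> x = \<zero>"
  using star_iff[of "star x" x] by simp

lemma star_zero [simp]: "star \<zero> = \<one>"
  using star_iff[of \<one> \<zero>] by (simp add: le_antisym)

lemma star_one [simp]: "star \<one> = \<zero>"
  by (metis closed(2,3) meet_star one_meet)

lemma le_zero: "x \<in> C \<Longrightarrow> x \<sqsubseteq> \<zero> \<longleftrightarrow> x = \<zero>"
  by (auto simp: ple_def)

lemma le_and_le_star: "x \<sqsubseteq> y \<Longrightarrow> x \<sqsubseteq> star y \<Longrightarrow> x \<in> C \<Longrightarrow> y \<in> C \<Longrightarrow> x = \<zero>"
  using le_meet_iff[of y "star y" x] by (simp add: le_zero)

lemma star_join:
  assumes "x \<in> C" "y \<in> C"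
  shows "star (x \<squnion> y) = star x \<sqinter> star y"
proof (rule le_antisym)
  let ?s = "star (x \<squnion> y)"
  have "?s \<sqinter> z = \<zero>" if "z \<in> C" "z \<sqsubseteq> x \<squnion> y" for z
  proof (rule le_and_le_star)
    show "?s \<sqinter> z \<sqsubseteq> x \<squnion> y"
      using that assms by (intro le_trans[OF meet_le2]) auto
  qed (use that assms in auto)
  then have "?s \<sqinter> x = \<zero>" "?s \<sqinter> y = \<zero>" using assms by auto
  then show "?s \<sqsubseteq> star x \<sqinter> star y" using assms by (simp add: le_meet_iff star_iff)
  have "star x \<sqinter> star y \<sqinter> (x \<squnion> y) = star x \<sqinter> star y \<sqinter> x \<squnion> star x \<sqinter> star y \<sqinter> y"
    using assms by (simp add: distrib)
  also have "star x \<sqinter> star y \<sqinter> x = \<zero>"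
    using assms by (metis closed(3) meet_assoc meet_comm meet_zero star_meet)
  also have "star x \<sqinter> star y \<sqinter> y = \<zero>"
    using assms by (simp add: meet_assoc)
  finally show "star x \<sqinter> star y \<sqsubseteq> ?s" using assms by (simp add: star_iff[symmetric])
qed (use assms in auto)

text \<open>In the Boolean algebra of pseudocomplements, this is the biconditional of the double
  pseudocomplements of \<open>a\<close> and \<open>b\<close>. It serves as a canonical element below which \<open>star a\<close> and
  \<open>star b\<close> agree: it is \<open>\<one>\<close> modulo every congruence that identifies \<open>a\<close> and \<open>b\<close>.\<close>

definition agree :: "'a \<Rightarrow> 'a \<Rightarrow> 'a" where
  "agree a b = star (a \<sqinter> star b) \<sqinter> star (b \<sqinter> star a)"

lemma agree_closed [simp]: "a \<in> C \<Longrightarrow> b \<in> C \<Longrightarrow> agree a b \<in> C"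
  by (simp add: agree_def)

lemma agree_commute: "a \<in> C \<Longrightarrow> b \<in> C \<Longrightarrow> agree a b = agree b a"
  by (simp add: agree_def meet_comm)

lemma agree_le:
  assumes [simp]: "a \<in> C" "b \<in> C"
  shows "agree a b \<sqinter> star a \<sqsubseteq> star b"
proof -
  have "agree a b \<sqsubseteq> star (b \<sqinter> star a)" by (simp add: agree_def)
  then have "agree a b \<sqinter> (b \<sqinter> star a) = \<zero>" by (simp add: star_iff)
  then have "agree a b \<sqinter> star a \<sqinter> b = \<zero>" by (simp add: meet_ac)
  then show ?thesis by (simp add: star_iff)
qed

lemma agree_star:
  assumes [simp]: "a \<in> C" "b \<in> C"
  shows "agree a b \<sqinter> star a = agree a b \<sqinter> star b"
  using agree_le[of a b] agree_le[of b a]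
  by (intro le_antisym) (auto simp: le_meet_iff agree_commute[of b a])


section \<open>Filters saturated for a congruence\<close>

lemma ConD:
  assumes "\<theta> \<in> Con A"
  shows "(x, y) \<in> \<theta> \<Longrightarrow> x \<in> C" "(x, y) \<in> \<theta> \<Longrightarrow> y \<in> C" "x \<in> C \<Longrightarrow> (x, x) \<in> \<theta>"
    "(x, y) \<in> \<theta> \<Longrightarrow> (y, x) \<in> \<theta>" "(x, y) \<in> \<theta> \<Longrightarrow> (y, z) \<in> \<theta> \<Longrightarrow> (x, z) \<in> \<theta>"
    "(x, y) \<in> \<theta> \<Longrightarrow> (star x, star y) \<in> \<theta>"
    "(x, y) \<in> \<theta> \<Longrightarrow> (x', y') \<in> \<theta> \<Longrightarrow> (x \<sqinter> x', y \<sqinter> y') \<in> \<theta>"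
    "(x, y) \<in> \<theta> \<Longrightarrow> (x', y') \<in> \<theta> \<Longrightarrow> (x \<squnion> x', y \<squnion> y') \<in> \<theta>"
  using assms unfolding Con_def equiv_def refl_on_def sym_def trans_def by blast+

lemma ConI:
  assumes "\<theta> \<subseteq> C \<times> C" "\<And>x. x \<in> C \<Longrightarrow> (x, x) \<in> \<theta>"
    "\<And>x y. (x, y) \<in> \<theta> \<Longrightarrow> (y, x) \<in> \<theta>"
    "\<And>x y z. (x, y) \<in> \<theta> \<Longrightarrow> (y, z) \<in> \<theta> \<Longrightarrow> (x, z) \<in> \<theta>"
    "\<And>x y. (x, y) \<in> \<theta> \<Longrightarrow> (star x, star y) \<in> \<theta>"
    "\<And>x y x' y'. (x, y) \<in> \<theta> \<Longrightarrow> (x', y') \<in> \<theta> \<Longrightarrow> (x \<sqinter> x', y \<sqinter> y') \<in> \<theta>"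
    "\<And>x y x' y'. (x, y) \<in> \<theta> \<Longrightarrow> (x', y') \<in> \<theta> \<Longrightarrow> (x \<squnion> x', y \<squnion> y') \<in> \<theta>"
  shows "\<theta> \<in> Con A"
proof -
  have "equiv C \<theta>"
    using assms(1) by (rule equivI) (auto intro: refl_onI symI transI assms(2-4))
  then show ?thesis
    unfolding Con_def by (auto intro: assms(5-7))
qed

lemma Id_on_Con: "Id_on C \<in> Con A"
  by (rule ConI) auto

text \<open>Modulo \<open>\<theta>\<close> one may replace \<open>b\<close> by \<open>a\<close>, and \<open>agree a a\<close> is \<open>\<one>\<close>.\<close>

lemma Con_agree:
  assumes "\<theta> \<in> Con A" "(a, b) \<in> \<theta>"
  shows "(\<one>, agree a b) \<in> \<theta>"
proof -
  note c = ConD[OF assms(1)]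
  have [simp]: "a \<in> C" "b \<in> C" using c(1,2) assms(2) by auto
  have "(agree a a, agree a b) \<in> \<theta>"
    unfolding agree_def using assms(2) by (intro c(6,7)) (auto intro: c(3) c(6))
  then show ?thesis by (simp add: agree_def)
qed

text \<open>These are the preimages of the filters of the quotient by \<open>\<theta>\<close>: the last condition says that
  \<open>F\<close> is closed upwards with respect to the order modulo \<open>\<theta>\<close>. For \<open>\<theta> = Id_on C\<close> they are the
  ordinary filters, so one separation lemma serves both for the algebra and for its quotients.\<close>

definition con_filter :: "('a \<times> 'a) set \<Rightarrow> 'a set \<Rightarrow> bool" where
  "con_filter \<theta> F \<longleftrightarrow> F \<subseteq> C \<and> \<one> \<in> F \<and> (\<forall>x\<in>F. \<forall>y\<in>F. x \<sqinter> y \<in> F) \<and>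
     (\<forall>x\<in>F. \<forall>y\<in>C. (x \<sqinter> y, x) \<in> \<theta> \<longrightarrow> y \<in> F)"

lemma con_filter_saturated:
  assumes "\<theta> \<in> Con A" "con_filter \<theta> F" "(x, y) \<in> \<theta>"
  shows "x \<in> F \<longleftrightarrow> y \<in> F"
proof -
  have "y \<in> F" if "x \<in> F" "(x, y) \<in> \<theta>" for x y
  proof -
    note c = ConD[OF assms(1)]
    have [simp]: "x \<in> C" "y \<in> C" using c(1,2) that(2) by auto
    have "(x \<sqinter> x, x \<sqinter> y) \<in> \<theta>" by (intro c(7) that c(3)) simp
    then show ?thesis using assms(2) that(1) c(4) by (auto simp: con_filter_def)
  qed
  then show ?thesis using assms(3) ConD(4)[OF assms(1)] by blast
qed

text \<open>The set \<open>G\<close> consists of the elements above some \<open>f \<sqinter> x\<close> modulo \<open>\<theta>\<close>. Enlarging a filter by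
  one element in this way is the step that makes maximal filters prime.\<close>

lemma con_filter_adjoin:
  assumes \<theta>: "\<theta> \<in> Con A" and F: "con_filter \<theta> F" and x [simp]: "x \<in> C"
  defines "G \<equiv> {z \<in> C. \<exists>f\<in>F. (f \<sqinter> x \<sqinter> z, f \<sqinter> x) \<in> \<theta>}"
  shows "con_filter \<theta> G" "F \<subseteq> G" "x \<in> G"
proof -
  note c = ConD[OF \<theta>]
  have FC: "f \<in> C" if "f \<in> F" for f using that F by (auto simp: con_filter_def)
  have one: "\<one> \<in> F" using F by (auto simp: con_filter_def)
  show "F \<subseteq> G"
  proof
    fix z assume "z \<in> F"
    moreover have [simp]: "z \<in> C" using FC \<open>z \<in> F\<close> by blast
    moreover have "z \<sqinter> x \<sqinter> z = z \<sqinter> x" by (simp add: meet_ac)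
    ultimately show "z \<in> G" unfolding G_def using c(3)[of "z \<sqinter> x"]
      by (auto intro!: bexI[of _ z])
  qed
  then have "\<one> \<in> G" using one by blast
  show "x \<in> G"
    unfolding G_def using one c(3)[of x] by (auto intro!: bexI[of _ \<one>])
  have "z \<sqinter> w \<in> G" if zw: "z \<in> G" "w \<in> G" for z w
  proof -
    obtain f g where f: "f \<in> F" "(f \<sqinter> x \<sqinter> z, f \<sqinter> x) \<in> \<theta>" and g: "g \<in> F" "(g \<sqinter> x \<sqinter> w, g \<sqinter> x) \<in> \<theta>"
      using zw by (auto simp: G_def)
    have [simp]: "z \<in> C" "w \<in> C" "f \<in> C" "g \<in> C" using zw FC f g by (auto simp: G_def)
    have "((f \<sqinter> x \<sqinter> z) \<sqinter> (g \<sqinter> x \<sqinter> w), (f \<sqinter> x) \<sqinter> (g \<sqinter> x)) \<in> \<theta>" using f g c(7) by blast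
    also have "(f \<sqinter> x \<sqinter> z) \<sqinter> (g \<sqinter> x \<sqinter> w) = (f \<sqinter> g) \<sqinter> x \<sqinter> (z \<sqinter> w)" by (simp add: meet_ac)
    also have "(f \<sqinter> x) \<sqinter> (g \<sqinter> x) = (f \<sqinter> g) \<sqinter> x" by (simp add: meet_ac)
    finally show ?thesis
      unfolding G_def using f(1) g(1) F by (auto simp: con_filter_def)
  qed
  moreover have "w \<in> G" if z: "z \<in> G" and w [simp]: "w \<in> C" and zw: "(z \<sqinter> w, z) \<in> \<theta>" for z w
  proof -
    obtain f where f: "f \<in> F" "(f \<sqinter> x \<sqinter> z, f \<sqinter> x) \<in> \<theta>"
      using z by (auto simp: G_def)
    have [simp]: "z \<in> C" "f \<in> C" using z FC f by (auto simp: G_def)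
    have "((f \<sqinter> x) \<sqinter> w, (f \<sqinter> x \<sqinter> z) \<sqinter> w) \<in> \<theta>" by (intro c(7) c(4)[OF f(2)] c(3)) simp
    also have "(f \<sqinter> x \<sqinter> z) \<sqinter> w = (f \<sqinter> x) \<sqinter> (z \<sqinter> w)" by (simp add: meet_assoc)
    finally have "((f \<sqinter> x) \<sqinter> w, (f \<sqinter> x) \<sqinter> (z \<sqinter> w)) \<in> \<theta>" .
    moreover have "((f \<sqinter> x) \<sqinter> (z \<sqinter> w), (f \<sqinter> x) \<sqinter> z) \<in> \<theta>" by (intro c(7) zw c(3)) simp
    ultimately have "(f \<sqinter> x \<sqinter> w, f \<sqinter> x) \<in> \<theta>" using c(5)[OF c(5) f(2)] by blast
    then show ?thesis unfolding G_def using f(1) by auto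
  qed
  ultimately show "con_filter \<theta> G"
    using \<open>\<one> \<in> G\<close> unfolding con_filter_def G_def by blast
qed

lemma con_filter_principal:
  assumes \<theta>: "\<theta> \<in> Con A" and a [simp]: "a \<in> C"
  shows "con_filter \<theta> {z \<in> C. (a \<sqinter> z, a) \<in> \<theta>}"
proof -
  note c = ConD[OF \<theta>]
  have "(a \<sqinter> (x \<sqinter> y), a) \<in> \<theta>" if "(a \<sqinter> x, a) \<in> \<theta>" "(a \<sqinter> y, a) \<in> \<theta>" "x \<in> C" "y \<in> C" for x y
  proof -
    have "((a \<sqinter> x) \<sqinter> (a \<sqinter> y), a \<sqinter> a) \<in> \<theta>" using that c(7) by blast
    also have "(a \<sqinter> x) \<sqinter> (a \<sqinter> y) = a \<sqinter> (x \<sqinter> y)" using that by (simp add: meet_ac)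
    finally show ?thesis by simp
  qed
  moreover have "(a \<sqinter> y, a) \<in> \<theta>"
    if "(a \<sqinter> x, a) \<in> \<theta>" "(x \<sqinter> y, x) \<in> \<theta>" and [simp]: "x \<in> C" "y \<in> C" for x y
  proof -
    have "(a \<sqinter> y, (a \<sqinter> x) \<sqinter> y) \<in> \<theta>" by (intro c(7) c(4)[OF that(1)] c(3)) simp
    also have "(a \<sqinter> x) \<sqinter> y = a \<sqinter> (x \<sqinter> y)" by (simp add: meet_assoc)
    finally have "(a \<sqinter> y, a \<sqinter> (x \<sqinter> y)) \<in> \<theta>" .
    moreover have "(a \<sqinter> (x \<sqinter> y), a \<sqinter> x) \<in> \<theta>" by (intro c(7) that c(3)) simp
    ultimately show ?thesis using c(5)[OF c(5) that(1)] by blast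
  qed
  ultimately show ?thesis unfolding con_filter_def using c(3)[of a] by auto
qed

lemma prime_filterD:
  assumes "P \<in> prime_filters A"
  shows "P \<subseteq> C" "\<one> \<in> P" "\<zero> \<notin> P" "x \<in> P \<Longrightarrow> x \<sqsubseteq> y \<Longrightarrow> y \<in> C \<Longrightarrow> y \<in> P"
    "x \<in> C \<Longrightarrow> y \<in> C \<Longrightarrow> x \<sqinter> y \<in> P \<longleftrightarrow> x \<in> P \<and> y \<in> P"
    "x \<in> C \<Longrightarrow> y \<in> C \<Longrightarrow> x \<squnion> y \<in> P \<longleftrightarrow> x \<in> P \<or> y \<in> P"
proof -
  have sub: "P \<subseteq> C" and up: "\<And>x y. x \<in> P \<Longrightarrow> x \<sqsubseteq> y \<Longrightarrow> y \<in> C \<Longrightarrow> y \<in> P"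
    and meet: "\<And>x y. x \<in> P \<Longrightarrow> y \<in> P \<Longrightarrow> x \<sqinter> y \<in> P" and P: "P \<noteq> {}" "P \<noteq> C"
    and join: "\<And>x y. x \<in> C \<Longrightarrow> y \<in> C \<Longrightarrow> x \<squnion> y \<in> P \<Longrightarrow> x \<in> P \<or> y \<in> P"
    using assms by (auto simp: prime_filters_def)
  show "P \<subseteq> C" by (fact sub)
  show "\<one> \<in> P" using P(1) up sub by (meson closed(2) equals0I le_one subsetD)
  show "\<zero> \<notin> P" using P(2) up sub by (meson subset_antisym subsetI zero_le)
  show "x \<in> P \<Longrightarrow> x \<sqsubseteq> y \<Longrightarrow> y \<in> C \<Longrightarrow> y \<in> P" by (fact up)
  show "x \<in> C \<Longrightarrow> y \<in> C \<Longrightarrow> x \<sqinter> y \<in> P \<longleftrightarrow> x \<in> P \<and> y \<in> P"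
    using up[of "x \<sqinter> y" x] up[of "x \<sqinter> y" y] meet[of x y] by auto
  show "x \<in> C \<Longrightarrow> y \<in> C \<Longrightarrow> x \<squnion> y \<in> P \<longleftrightarrow> x \<in> P \<or> y \<in> P"
    using up[of x "x \<squnion> y"] up[of y "x \<squnion> y"] join[of x y] by auto
qed

lemma prime_filterI:
  assumes "\<theta> \<in> Con A" "con_filter \<theta> P" "\<zero> \<notin> P"
    "\<And>x y. x \<in> C \<Longrightarrow> y \<in> C \<Longrightarrow> x \<squnion> y \<in> P \<Longrightarrow> x \<in> P \<or> y \<in> P"
  shows "P \<in> prime_filters A"
proof -
  have "y \<in> P" if "x \<in> P" "y \<in> C" "x \<sqsubseteq> y" for x y
    using assms(2) that ConD(3)[OF assms(1), of x] by (auto simp: con_filter_def ple_def)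
  moreover have "P \<noteq> C" using assms(3) closed(1) by blast
  ultimately show ?thesis
    using assms(2,4) unfolding prime_filters_def con_filter_def by blast
qed

lemma prime_con_filter_Id:
  assumes "P \<in> prime_filters A"
  shows "con_filter (Id_on C) P"
  using prime_filterD(1,2)[OF assms] prime_filterD(5)[OF assms]
  unfolding con_filter_def by auto (metis subsetD)+


section \<open>The congruence of a prime filter\<close>

text \<open>In the dual space, \<open>P\<close> is a point, and the congruence corresponds to the subspace that consists
  of \<open>P\<close> and the maximal filters above it: agreement of pseudocomplements below an element of \<open>P\<close> means
  that no maximal filter above \<open>P\<close> separates \<open>a\<close> and \<open>b\<close>. The existential form, compared with
  \<open>agree a b \<in> P\<close>, makes transitivity and compatibility with joins straightforward.\<close>

definition prime_con :: "'a set \<Rightarrow> ('a \<times> 'a) set" where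
  "prime_con P =
    {(a, b) \<in> C \<times> C. (a \<in> P \<longleftrightarrow> b \<in> P) \<and> (\<exists>p\<in>P. p \<sqinter> star a = p \<sqinter> star b)}"

lemma le_transfer:
  assumes "p \<sqinter> s = p \<sqinter> t" "y \<sqsubseteq> p" "y \<sqsubseteq> s" "p \<in> C" "s \<in> C" "t \<in> C" "y \<in> C"
  shows "y \<sqsubseteq> t"
  using assms by (metis le_meet_iff)

text \<open>This makes \<open>prime_con\<close> compatible with meets. An element below \<open>p\<close>, \<open>b\<close>, \<open>d\<close> and \<open>star (a \<sqinter> c)\<close> vanishes:
  its meet with \<open>a\<close> is below \<open>star c\<close>, hence below \<open>star d\<close>, and is \<open>\<zero>\<close>; so the element is below
  \<open>star a\<close>, hence below \<open>star b\<close>.\<close>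

lemma star_meet_transfer:
  assumes ab: "p \<sqinter> star a = p \<sqinter> star b" and cd: "p \<sqinter> star c = p \<sqinter> star d"
    and [simp]: "p \<in> C" "a \<in> C" "b \<in> C" "c \<in> C" "d \<in> C"
  shows "p \<sqinter> star (a \<sqinter> c) \<sqsubseteq> star (b \<sqinter> d)"
proof -
  define x where "x = p \<sqinter> star (a \<sqinter> c) \<sqinter> (b \<sqinter> d)"
  have [simp]: "x \<in> C" by (simp add: x_def)
  have "x \<sqsubseteq> x" by simp
  then have x: "x \<sqsubseteq> p" "x \<sqsubseteq> star (a \<sqinter> c)" "x \<sqsubseteq> b" "x \<sqsubseteq> d"
    by (subst (asm) (2) x_def; simp add: le_meet_iff)+
  have xa: "x \<sqinter> a \<sqsubseteq> z" if "x \<sqsubseteq> z" "z \<in> C" for z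
    using le_trans[OF meet_le1 that(1)] that(2) by simp
  have "x \<sqinter> a \<sqinter> c = \<zero>" using x(2) star_iff[of x "a \<sqinter> c"] by (simp add: meet_assoc)
  then have "x \<sqinter> a \<sqsubseteq> star c" by (simp add: star_iff)
  then have "x \<sqinter> a \<sqsubseteq> star d" using le_transfer[OF cd xa[OF x(1)]] by simp
  then have "x \<sqinter> a = \<zero>" using le_and_le_star[OF xa[OF x(4)]] by simp
  then have "x \<sqsubseteq> star a" by (simp add: star_iff)
  then have "x \<sqsubseteq> star b" using le_transfer[OF ab x(1)] by simp
  then have "x = \<zero>" using le_and_le_star[OF x(3)] by simp
  then show ?thesis unfolding x_def by (simp add: star_iff)
qed

lemma star_star_transfer:
  assumes ab: "p \<sqinter> star a = p \<sqinter> star b" and [simp]: "p \<in> C" "a \<in> C" "b \<in> C"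
  shows "p \<sqinter> star (star a) \<sqsubseteq> star (star b)"
proof -
  have "p \<sqinter> star (star a) \<sqinter> star b = (p \<sqinter> star b) \<sqinter> star (star a)" by (simp add: meet_ac)
  also have "\<dots> = \<zero>" by (simp add: ab[symmetric] meet_assoc)
  finally show ?thesis by (simp add: star_iff)
qed

lemma meet_eqI:
  assumes "p \<sqinter> s \<sqsubseteq> t" "p \<sqinter> t \<sqsubseteq> s" "p \<in> C" "s \<in> C" "t \<in> C"
  shows "p \<sqinter> s = p \<sqinter> t"
  using assms by (intro le_antisym) (auto simp: le_meet_iff)

lemma prime_con_Con:
  assumes P: "P \<in> prime_filters A"
  shows "prime_con P \<in> Con A"
proof (rule ConI)
  note p = prime_filterD[OF P]
  show "prime_con P \<subseteq> C \<times> C" by (auto simp: prime_con_def)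
  show "x \<in> C \<Longrightarrow> (x, x) \<in> prime_con P" for x using p(2) by (auto simp: prime_con_def)
  show "(x, y) \<in> prime_con P \<Longrightarrow> (y, x) \<in> prime_con P" for x y
    by (clarsimp simp: prime_con_def) metis
  \<comment> \<open>Two witnesses may be replaced by their meet.\<close>
  have common: "\<exists>p\<in>P. p \<sqinter> s = p \<sqinter> t \<and> p \<sqinter> s' = p \<sqinter> t'"
    if qr: "q \<in> P" "q \<sqinter> s = q \<sqinter> t" "r \<in> P" "r \<sqinter> s' = r \<sqinter> t'"
      and [simp]: "s \<in> C" "t \<in> C" "s' \<in> C" "t' \<in> C" for q r s t s' t'
  proof (intro bexI conjI)
    have [simp]: "q \<in> C" "r \<in> C" using qr p(1) by auto
    show "q \<sqinter> r \<in> P" using qr p(5) by simp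
    show "q \<sqinter> r \<sqinter> s' = q \<sqinter> r \<sqinter> t'" using qr(4) by (simp add: meet_assoc)
    have "r \<sqinter> (q \<sqinter> s) = r \<sqinter> (q \<sqinter> t)" using qr(2) by simp
    then show "q \<sqinter> r \<sqinter> s = q \<sqinter> r \<sqinter> t" by (simp add: meet_ac)
  qed
  show "(x, z) \<in> prime_con P" if xyz: "(x, y) \<in> prime_con P" "(y, z) \<in> prime_con P" for x y z
  proof -
    have C: "x \<in> C" "y \<in> C" "z \<in> C" using xyz by (auto simp: prime_con_def)
    obtain q r where qr: "q \<in> P" "q \<sqinter> star x = q \<sqinter> star y" "r \<in> P" "r \<sqinter> star y = r \<sqinter> star z"
      using xyz unfolding prime_con_def by blast
    have "\<exists>p\<in>P. p \<sqinter> star x = p \<sqinter> star z" using common[OF qr] C by force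
    then show ?thesis using xyz C unfolding prime_con_def by blast
  qed
  show "(star x, star y) \<in> prime_con P" if xy: "(x, y) \<in> prime_con P" for x y
  proof -
    obtain q where q: "q \<in> P" "q \<sqinter> star x = q \<sqinter> star y" and [simp]: "x \<in> C" "y \<in> C"
      using xy by (auto simp: prime_con_def)
    have [simp]: "q \<in> C" using q p(1) by blast
    have "star x \<in> P \<longleftrightarrow> star y \<in> P" using q p(5)[of q "star x"] p(5)[of q "star y"] by simp
    moreover have "q \<sqinter> star (star x) = q \<sqinter> star (star y)"
      by (rule meet_eqI[OF star_star_transfer[OF q(2)] star_star_transfer[OF q(2)[symmetric]]])
        simp_all
    ultimately show ?thesis using q(1) by (auto simp: prime_con_def)
  qed
  fix a b c d assume abcd: "(a, b) \<in> prime_con P" "(c, d) \<in> prime_con P"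
  have [simp]: "a \<in> C" "b \<in> C" "c \<in> C" "d \<in> C" using abcd by (auto simp: prime_con_def)
  have eq: "a \<in> P \<longleftrightarrow> b \<in> P" "c \<in> P \<longleftrightarrow> d \<in> P" using abcd by (auto simp: prime_con_def)
  obtain q r where qr: "q \<in> P" "q \<sqinter> star a = q \<sqinter> star b" "r \<in> P" "r \<sqinter> star c = r \<sqinter> star d"
    using abcd unfolding prime_con_def by blast
  obtain s where s: "s \<in> P" "s \<sqinter> star a = s \<sqinter> star b" "s \<sqinter> star c = s \<sqinter> star d"
    using common[OF qr] by auto
  have [simp]: "s \<in> C" using s p(1) by blast
  have "s \<sqinter> star (a \<sqinter> c) = s \<sqinter> star (b \<sqinter> d)"
    by (rule meet_eqI[OF star_meet_transfer[OF s(2,3)]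
          star_meet_transfer[OF s(2,3)[symmetric]]]) simp_all
  then show "(a \<sqinter> c, b \<sqinter> d) \<in> prime_con P"
    using s(1) eq by (auto simp: prime_con_def p(5))
  have "s \<sqinter> (star a \<sqinter> star c) = (s \<sqinter> star a) \<sqinter> (s \<sqinter> star c)"
    by (simp add: meet_ac)
  also have "\<dots> = s \<sqinter> (star b \<sqinter> star d)"
    unfolding s by (simp add: meet_ac)
  finally show "(a \<squnion> c, b \<squnion> d) \<in> prime_con P"
    using s(1) eq by (auto simp: prime_con_def p(6) star_join)
qed

text \<open>For \<open>a \<in> P\<close> the element \<open>a\<close> itself is a witness, as \<open>a \<sqinter> star a = \<zero> = a \<sqinter> star \<one>\<close>.\<close>

lemma prime_con_class:
  assumes P: "P \<in> prime_filters A"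
  shows "prime_con P `` {\<one>} = P"
proof -
  note p = prime_filterD[OF P]
  have "\<exists>p\<in>P. p \<sqinter> star \<one> = p \<sqinter> star a" if "a \<in> P" for a
    using that p(1) by (intro bexI[of _ a]) auto
  then show ?thesis using p(1,2) unfolding prime_con_def by fastforce
qed

lemma prime_conI:
  assumes "a \<in> C" "b \<in> C" "a \<in> P \<longleftrightarrow> b \<in> P" "agree a b \<in> P"
  shows "(a, b) \<in> prime_con P"
  using assms agree_star[of a b] unfolding prime_con_def by blast

text \<open>If \<open>\<theta>\<close> identifies \<open>a\<close> and \<open>b\<close>, then \<open>agree a b\<close> is in the class of \<open>\<one>\<close> and hence in \<open>P\<close>.\<close>

lemma Con_le_prime_con:
  assumes "\<theta> \<in> Con A" "con_filter \<theta> P"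
  shows "\<theta> \<subseteq> prime_con P"
proof (rule subrelI)
  fix a b assume ab: "(a, b) \<in> \<theta>"
  have "agree a b \<in> P"
    using con_filter_saturated[OF assms Con_agree[OF assms(1) ab]] assms(2)
    by (auto simp: con_filter_def)
  then show "(a, b) \<in> prime_con P"
    using con_filter_saturated[OF assms ab] ConD(1,2)[OF assms(1) ab] by (intro prime_conI) auto
qed

end


section \<open>Finite p-algebras\<close>

locale finite_p_alg = p_alg +
  assumes fin: "finite C"
begin

text \<open>A filter that is maximal among those missing \<open>b\<close> is prime: if it contained \<open>x \<squnion> y\<close> but
  neither \<open>x\<close> nor \<open>y\<close>, adjoining either of them would yield \<open>b\<close>, and by distributivity \<open>b\<close> would
  follow already from \<open>x \<squnion> y\<close>.\<close>

lemma prime_filter_separation: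
  assumes \<theta>: "\<theta> \<in> Con A" and F: "con_filter \<theta> F" and b [simp]: "b \<in> C" and bF: "b \<notin> F"
  shows "\<exists>P\<in>prime_filters A. con_filter \<theta> P \<and> F \<subseteq> P \<and> b \<notin> P"
proof -
  note c = ConD[OF \<theta>]
  let ?S = "{G. con_filter \<theta> G \<and> b \<notin> G}"
  have "finite ?S" by (rule finite_subset[of _ "Pow C"]) (auto simp: con_filter_def fin)
  then obtain P where P: "con_filter \<theta> P" "b \<notin> P" "F \<subseteq> P"
    and max: "\<And>G. con_filter \<theta> G \<Longrightarrow> b \<notin> G \<Longrightarrow> P \<subseteq> G \<Longrightarrow> P = G"
    using finite_has_maximal2[of ?S F] F bF by auto
  have sat: "y \<in> P" if "x \<in> P" "y \<in> C" "(x \<sqinter> y, x) \<in> \<theta>" for x y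
    using P(1) that by (auto simp: con_filter_def)
  have meetP: "x \<sqinter> y \<in> P" if "x \<in> P" "y \<in> P" for x y
    using P(1) that by (auto simp: con_filter_def)
  have PC: "x \<in> C" if "x \<in> P" for x using P(1) that by (auto simp: con_filter_def)
  have zero: "\<zero> \<notin> P"
    using sat[of \<zero> b] P(2) c(3)[of \<zero>] by auto
  have grow: "\<exists>f\<in>P. (f \<sqinter> x \<sqinter> b, f \<sqinter> x) \<in> \<theta>" if "x \<in> C" "x \<notin> P" for x
    using con_filter_adjoin[OF \<theta> P(1) that(1)] max that(2) by blast
  have shrink: "((f \<sqinter> g) \<sqinter> x \<sqinter> b, (f \<sqinter> g) \<sqinter> x) \<in> \<theta>"
    if "(f \<sqinter> x \<sqinter> b, f \<sqinter> x) \<in> \<theta>" and [simp]: "f \<in> C" "g \<in> C" "x \<in> C" for f g x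
  proof -
    have "(g \<sqinter> (f \<sqinter> x \<sqinter> b), g \<sqinter> (f \<sqinter> x)) \<in> \<theta>" by (intro c(7) that(1) c(3)) simp
    then show ?thesis by (simp add: meet_ac)
  qed
  have "x \<in> P \<or> y \<in> P" if xy [simp]: "x \<in> C" "y \<in> C" and "x \<squnion> y \<in> P" for x y
  proof (rule ccontr)
    assume "\<not> (x \<in> P \<or> y \<in> P)"
    then obtain f g where f: "f \<in> P" "(f \<sqinter> x \<sqinter> b, f \<sqinter> x) \<in> \<theta>"
      and g: "g \<in> P" "(g \<sqinter> y \<sqinter> b, g \<sqinter> y) \<in> \<theta>"
      using grow by (meson xy)
    have [simp]: "f \<in> C" "g \<in> C" using f g PC by auto
    \<comment> \<open>Below \<open>?h\<close> both \<open>x\<close> and \<open>y\<close> are below \<open>b\<close> modulo \<open>\<theta>\<close>, and so is \<open>x \<squnion> y\<close>.\<close>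
    let ?h = "f \<sqinter> g"
    have "(?h \<sqinter> x \<sqinter> b, ?h \<sqinter> x) \<in> \<theta>" "(?h \<sqinter> y \<sqinter> b, ?h \<sqinter> y) \<in> \<theta>"
      using shrink[OF f(2), of g] shrink[OF g(2), of f] by (simp_all add: meet_comm[of g f])
    then have "(?h \<sqinter> x \<sqinter> b \<squnion> ?h \<sqinter> y \<sqinter> b, ?h \<sqinter> x \<squnion> ?h \<sqinter> y) \<in> \<theta>" by (rule c(8))
    also have "?h \<sqinter> x \<squnion> ?h \<sqinter> y = ?h \<sqinter> (x \<squnion> y)" by (simp add: distrib)
    also have "?h \<sqinter> x \<sqinter> b \<squnion> ?h \<sqinter> y \<sqinter> b = b \<sqinter> (?h \<sqinter> x) \<squnion> b \<sqinter> (?h \<sqinter> y)"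
      by (simp add: meet_comm[of b])
    also have "\<dots> = b \<sqinter> (?h \<sqinter> (x \<squnion> y))" by (simp add: distrib)
    also have "\<dots> = ?h \<sqinter> (x \<squnion> y) \<sqinter> b" by (simp add: meet_comm[of b])
    finally have "(?h \<sqinter> (x \<squnion> y) \<sqinter> b, ?h \<sqinter> (x \<squnion> y)) \<in> \<theta>" .
    then have "b \<in> P" using sat[OF meetP[OF meetP[OF f(1) g(1)] \<open>x \<squnion> y \<in> P\<close>]] by simp
    then show False using P(2) by blast
  qed
  then show ?thesis using prime_filterI[OF \<theta> P(1) zero] P by blast
qed

lemma Con_separation:
  assumes \<theta>: "\<theta> \<in> Con A" and [simp]: "a \<in> C" "b \<in> C" and ab: "(a, b) \<notin> \<theta>"
  shows "\<exists>P\<in>prime_filters A. con_filter \<theta> P \<and> (a \<in> P \<longleftrightarrow> b \<notin> P)"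
proof -
  note c = ConD[OF \<theta>]
  have *: "\<exists>P\<in>prime_filters A. con_filter \<theta> P \<and> a \<in> P \<and> b \<notin> P"
    if not_below: "(a \<sqinter> b, a) \<notin> \<theta>" and [simp]: "a \<in> C" "b \<in> C" for a b
  proof -
    have "a \<in> {z \<in> C. (a \<sqinter> z, a) \<in> \<theta>}" using c(3)[of a] by auto
    moreover obtain P where "P \<in> prime_filters A" "con_filter \<theta> P"
      "{z \<in> C. (a \<sqinter> z, a) \<in> \<theta>} \<subseteq> P" "b \<notin> P"
      using prime_filter_separation[OF \<theta> con_filter_principal[OF \<theta>, of a], of b] not_below by auto
    ultimately show ?thesis by blast
  qed
  have "(a \<sqinter> b, a) \<notin> \<theta> \<or> (b \<sqinter> a, b) \<notin> \<theta>"
    using ab c(4,5) by (metis assms(2,3) meet_comm)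
  then show ?thesis using *[of a b] *[of b a] by auto
qed

text \<open>This is the join of \<open>S\<close>; the second property is the form in which primality extends to finite
  joins.\<close>

lemma finite_join:
  assumes "finite S" "S \<subseteq> C"
  shows "\<exists>m\<in>C. (\<forall>x\<in>S. x \<sqsubseteq> m) \<and> (\<forall>P\<in>prime_filters A. m \<in> P \<longrightarrow> (\<exists>x\<in>S. x \<in> P))"
  using assms
proof (induction S)
  case empty
  then show ?case using prime_filterD(3) by (auto intro!: bexI[of _ \<zero>])
next
  case (insert x S)
  then obtain m where m: "m \<in> C" "\<forall>x\<in>S. x \<sqsubseteq> m" "\<forall>P\<in>prime_filters A. m \<in> P \<longrightarrow> (\<exists>x\<in>S. x \<in> P)"
    by auto
  have "y \<sqsubseteq> x \<squnion> m" if "y \<in> S" for y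
    using le_trans[of y m "x \<squnion> m"] m(1,2) insert.prems that by auto
  then show ?case
    using m insert.prems by (intro bexI[of _ "x \<squnion> m"]) (auto simp: prime_filterD(6))
qed

lemma finite_meet:
  assumes "finite S" "S \<subseteq> C"
  shows "\<exists>m\<in>C. (\<forall>x\<in>S. m \<sqsubseteq> x) \<and> (\<forall>P\<in>prime_filters A. S \<subseteq> P \<longrightarrow> m \<in> P)"
  using assms
proof (induction S)
  case empty
  then show ?case using prime_filterD(2) by (auto intro!: bexI[of _ \<one>])
next
  case (insert x S)
  then obtain m where m: "m \<in> C" "\<forall>x\<in>S. m \<sqsubseteq> x" "\<forall>P\<in>prime_filters A. S \<subseteq> P \<longrightarrow> m \<in> P"
    by auto
  have "x \<sqinter> m \<sqsubseteq> y" if "y \<in> S" for y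
    using le_trans[of "x \<sqinter> m" m y] m(1,2) insert.prems that by auto
  then show ?case
    using m insert.prems by (intro bexI[of _ "x \<sqinter> m"]) (auto simp: prime_filterD(5))
qed

lemma prime_filter_least:
  assumes P: "P \<in> prime_filters A"
  obtains j where "j \<in> P" "\<And>x. x \<in> C \<Longrightarrow> x \<in> P \<longleftrightarrow> j \<sqsubseteq> x"
proof -
  note p = prime_filterD[OF P]
  obtain j where "j \<in> P" "\<forall>x\<in>P. j \<sqsubseteq> x"
    using finite_meet[of P] finite_subset[OF p(1) fin] p(1) P by blast
  then show ?thesis using p(4) that by blast
qed

lemma prime_filter_complement_greatest:
  assumes P: "P \<in> prime_filters A"
  obtains m where "m \<in> C" "\<And>x. x \<in> C \<Longrightarrow> x \<in> P \<longleftrightarrow> \<not> x \<sqsubseteq> m"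
proof -
  obtain m where "m \<in> C" "\<forall>x\<in>C - P. x \<sqsubseteq> m" "m \<notin> P"
    using finite_join[of "C - P"] fin P by blast
  then show ?thesis using prime_filterD(4)[OF P] that by blast
qed

text \<open>A completely meet-irreducible congruence omits a pair that all larger congruences contain. A
  prime filter separating that pair yields a congruence \<open>prime_con P\<close> above \<open>\<mu>\<close> that still omits the
  pair, hence equals \<open>\<mu>\<close>. Conversely, a pair in \<open>\<theta>\<close> but not in \<open>prime_con P\<close> provides, either directly
  or through \<open>agree\<close>, an element outside \<open>P\<close> that \<open>\<theta>\<close> identifies with \<open>\<one>\<close>; joining it with the
  greatest element \<open>m\<close> outside \<open>P\<close> shows that \<open>\<theta>\<close> identifies \<open>m\<close> with \<open>\<one>\<close>.\<close>

theorem Cm_eq: "Cm A = prime_con ` prime_filters A"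
proof (intro equalityI subsetI)
  fix \<mu> assume "\<mu> \<in> Cm A"
  then have \<mu>: "\<mu> \<in> Con A" "\<mu> \<noteq> \<Inter>{\<theta> \<in> Con A. \<mu> \<subset> \<theta>}" "\<mu> \<noteq> C \<times> C" by (auto simp: Cm_def)
  have sub: "\<mu> \<subset> C \<times> C" using ConD(1,2)[OF \<mu>(1)] \<mu>(3) by auto
  have "C \<times> C \<in> Con A" by (rule ConI) auto
  then have "\<Inter>{\<theta> \<in> Con A. \<mu> \<subset> \<theta>} \<subseteq> C \<times> C" using sub by blast
  then obtain a b where ab: "(a, b) \<in> C \<times> C" "(a, b) \<notin> \<mu>" "\<And>\<theta>. \<theta> \<in> Con A \<Longrightarrow> \<mu> \<subset> \<theta> \<Longrightarrow> (a, b) \<in> \<theta>"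
  proof -
    obtain z where "z \<in> \<Inter>{\<theta> \<in> Con A. \<mu> \<subset> \<theta>}" "z \<notin> \<mu>" using \<mu>(2) by auto
    then show thesis using that[of "fst z" "snd z"] sub \<open>C \<times> C \<in> Con A\<close> by auto
  qed
  then obtain P where P: "P \<in> prime_filters A" "con_filter \<mu> P" "a \<in> P \<longleftrightarrow> b \<notin> P"
    using Con_separation[OF \<mu>(1), of a b] by auto
  have "(a, b) \<notin> prime_con P" using P(3) by (auto simp: prime_con_def)
  then have "\<mu> = prime_con P"
    using Con_le_prime_con[OF \<mu>(1) P(2)] ab(3)[OF prime_con_Con[OF P(1)]] by blast
  then show "\<mu> \<in> prime_con ` prime_filters A" using P(1) by blast
next
  fix \<mu> assume "\<mu> \<in> prime_con ` prime_filters A"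
  then obtain P where P: "P \<in> prime_filters A" and \<mu>: "\<mu> = prime_con P" by blast
  note p = prime_filterD[OF P]
  obtain m where m: "m \<in> C" and mP: "\<And>x. x \<in> C \<Longrightarrow> x \<in> P \<longleftrightarrow> \<not> x \<sqsubseteq> m"
    using prime_filter_complement_greatest[OF P] by blast
  have "m \<notin> P" using mP m by auto
  have *: "(\<one>, m) \<in> \<theta>" if \<theta>: "\<theta> \<in> Con A" and less: "\<mu> \<subset> \<theta>" for \<theta>
  proof -
    note c = ConD[OF \<theta>]
    have below: "(\<one>, m) \<in> \<theta>" if "(\<one>, x) \<in> \<theta>" "x \<notin> P" for x
    proof -
      have x: "x \<in> C" using c(2) that by blast
      have "(\<one> \<squnion> m, x \<squnion> m) \<in> \<theta>" using that c(3)[OF m] by (intro c(8))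
      moreover have "x \<squnion> m = m"
        using mP[OF x] that(2) m x join_absorb[of m x] by (auto simp: ple_def meet_comm join_comm)
      ultimately show ?thesis using m by simp
    qed
    have inP: "(\<one>, m) \<in> \<theta>" if "(a, b) \<in> \<theta>" "a \<in> P" "b \<notin> P" for a b
    proof -
      have [simp]: "a \<in> C" "b \<in> C" using c(1,2) that(1) by auto
      have "(\<one>, a) \<in> \<mu>" using prime_con_class[OF P] that(2) \<mu> by blast
      then have "(\<one>, b) \<in> \<theta>" using less that(1) c(5) by blast
      then show ?thesis using below that(3) by blast
    qed
    obtain a b where ab: "(a, b) \<in> \<theta>" "(a, b) \<notin> prime_con P" using less \<mu> by auto
    show ?thesis
    proof (cases "a \<in> P \<longleftrightarrow> b \<in> P")
      case True
      then have "agree a b \<notin> P" using prime_conI[OF c(1,2)[OF ab(1)]] ab(2) by blast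
      then show ?thesis using below[OF Con_agree[OF \<theta> ab(1)]] by blast
    next
      case False
      then show ?thesis using inP[OF ab(1)] inP[OF c(4)[OF ab(1)]] by blast
    qed
  qed
  have "(\<one>, m) \<notin> \<mu>" using \<open>m \<notin> P\<close> p(2) by (auto simp: \<mu> prime_con_def)
  then have "\<mu> \<noteq> \<Inter>{\<theta> \<in> Con A. \<mu> \<subset> \<theta>}" "\<mu> \<noteq> C \<times> C" using * m by auto
  then show "\<mu> \<in> Cm A" using prime_con_Con[OF P] by (auto simp: Cm_def \<mu>)
qed

lemma le_Cm_prime_con:
  "P \<in> prime_filters A \<Longrightarrow> Q \<in> prime_filters A \<Longrightarrow>
    le_Cm A (prime_con P) (prime_con Q) \<longleftrightarrow> P \<subseteq> Q"
  by (simp add: le_Cm_def prime_con_class)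

lemma bij_prime_con: "bij_betw prime_con (prime_filters A) (Cm A)"
  unfolding Cm_eq by (intro bij_betw_imageI inj_onI refl) (metis prime_con_class)

text \<open>If \<open>star a \<notin> P\<close>, then \<open>f \<sqinter> a \<noteq> \<zero>\<close> for all \<open>f \<in> P\<close>, so \<open>P\<close> and \<open>a\<close> generate a proper filter,
  which extends to a prime filter.\<close>

lemma star_mem_prime_filter:
  assumes P: "P \<in> prime_filters A" and a [simp]: "a \<in> C"
  shows "star a \<in> P \<longleftrightarrow> (\<forall>Q\<in>prime_filters A. P \<subseteq> Q \<longrightarrow> a \<notin> Q)"
proof
  assume "star a \<in> P"
  then have "a \<notin> Q" if "Q \<in> prime_filters A" "P \<subseteq> Q" for Q
    using prime_filterD(3)[OF that(1)] prime_filterD(5)[OF that(1), of a "star a"] that(2) by auto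
  then show "\<forall>Q\<in>prime_filters A. P \<subseteq> Q \<longrightarrow> a \<notin> Q" by blast
next
  assume *: "\<forall>Q\<in>prime_filters A. P \<subseteq> Q \<longrightarrow> a \<notin> Q"
  show "star a \<in> P"
  proof (rule ccontr)
    assume "star a \<notin> P"
    note p = prime_filterD[OF P]
    let ?G = "{z \<in> C. \<exists>f\<in>P. (f \<sqinter> a \<sqinter> z, f \<sqinter> a) \<in> Id_on C}"
    note G = con_filter_adjoin[OF Id_on_Con prime_con_filter_Id[OF P] a]
    have "\<zero> \<notin> ?G"
    proof
      assume "\<zero> \<in> ?G"
      then obtain f where f: "f \<in> P" "f \<sqinter> a = \<zero>" using p(1) by auto
      then show False using p(1,4) \<open>star a \<notin> P\<close> star_iff[of f a] by auto
    qed
    then obtain Q where Q: "Q \<in> prime_filters A" "?G \<subseteq> Q"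
      using prime_filter_separation[OF Id_on_Con G(1) closed(1)] by blast
    have "P \<subseteq> Q" by (rule order_trans[OF G(2) Q(2)])
    moreover have "a \<in> Q" by (rule subsetD[OF Q(2) G(3)])
    ultimately show False using * Q(1) by blast
  qed
qed

text \<open>The isomorphism sends \<open>a\<close> to the set of prime filters that contain it. It is injective because
  prime filters separate the points, and an upset of prime filters is the image of the join of
  their least elements.\<close>

theorem piso_Up_prime_filters: "piso A (Up (prime_filters A) (\<subseteq>))"
proof -
  let ?h = "\<lambda>a. {P \<in> prime_filters A. a \<in> P}"
  have "?h \<in> phom A (Up (prime_filters A) (\<subseteq>))"
    unfolding phom_def Up_def
    by (auto simp: prime_filterD(2,3,5,6) star_mem_prime_filter)
  moreover have "inj_on ?h C"
  proof (rule inj_onI, rule ccontr)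
    fix a b assume ab: "a \<in> C" "b \<in> C" "?h a = ?h b" "a \<noteq> b"
    then obtain P where "P \<in> prime_filters A" "a \<in> P \<longleftrightarrow> b \<notin> P"
      using Con_separation[OF Id_on_Con, of a b] by auto
    then show False using ab(3) by blast
  qed
  moreover have "\<exists>a\<in>C. U = ?h a" if U: "U \<in> pcarrier (Up (prime_filters A) (\<subseteq>))" for U
  proof -
    have UP: "U \<subseteq> prime_filters A" and up: "\<And>P Q. P \<in> U \<Longrightarrow> Q \<in> prime_filters A \<Longrightarrow> P \<subseteq> Q \<Longrightarrow> Q \<in> U"
      using U by (auto simp: Up_def)
    have "\<exists>j. j \<in> P \<and> (\<forall>x\<in>C. x \<in> P \<longleftrightarrow> j \<sqsubseteq> x)" if "P \<in> U" for P
      by (rule prime_filter_least[OF subsetD[OF UP that]]) blast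
    then obtain j where j: "\<And>P. P \<in> U \<Longrightarrow> j P \<in> P" "\<And>P x. P \<in> U \<Longrightarrow> x \<in> C \<Longrightarrow> x \<in> P \<longleftrightarrow> j P \<sqsubseteq> x"
      by metis
    have "j ` U \<subseteq> C" using j(1) UP prime_filterD(1) by blast
    then obtain a where a: "a \<in> C" "\<forall>P\<in>U. j P \<sqsubseteq> a"
      "\<forall>Q\<in>prime_filters A. a \<in> Q \<longrightarrow> (\<exists>P\<in>U. j P \<in> Q)"
      using finite_join[OF finite_subset[OF _ fin], of "j ` U"] by auto
    have "U = ?h a"
    proof (intro equalityI subsetI)
      fix P assume "P \<in> U"
      then show "P \<in> ?h a" using j(2)[of P a] a(1,2) UP by auto
    next
      fix Q assume "Q \<in> ?h a"
      then have Q: "Q \<in> prime_filters A" and "a \<in> Q" by auto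
      then obtain P where P: "P \<in> U" "j P \<in> Q" using a(3) by blast
      have "P \<subseteq> C" using prime_filterD(1) UP P(1) by auto
      then have "P \<subseteq> Q" using j(2)[OF P(1)] prime_filterD(4)[OF Q P(2)] by auto
      then show "Q \<in> U" using up[OF P(1) Q] by blast
    qed
    then show ?thesis using a(1) by blast
  qed
  ultimately show ?thesis
    unfolding piso_def bij_betw_def phom_def by (intro bexI[of _ ?h]) auto
qed

lemma bij_principal_filter:
  "bij_betw (\<lambda>j. {x \<in> C. j \<sqsubseteq> x}) (join_irreducibles A) (prime_filters A)"
proof (rule bij_betw_imageI)
  show "inj_on (\<lambda>j. {x \<in> C. j \<sqsubseteq> x}) (join_irreducibles A)"
  proof (rule inj_onI)
    fix i j assume "i \<in> join_irreducibles A" "j \<in> join_irreducibles A"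
      and eq: "{x \<in> C. i \<sqsubseteq> x} = {x \<in> C. j \<sqsubseteq> x}"
    then have C: "i \<in> C" "j \<in> C" by (auto simp: join_irreducibles_def)
    then have "i \<sqsubseteq> j" "j \<sqsubseteq> i" using eq le_refl by blast+
    then show "i = j" using C by (intro le_antisym)
  qed
  show "(\<lambda>j. {x \<in> C. j \<sqsubseteq> x}) ` join_irreducibles A = prime_filters A"
  proof (intro equalityI subsetI)
    fix P assume "P \<in> (\<lambda>j. {x \<in> C. j \<sqsubseteq> x}) ` join_irreducibles A"
    then obtain j where P: "P = {x \<in> C. j \<sqsubseteq> x}" and [simp]: "j \<in> C" and j: "j \<noteq> \<zero>"
      "\<And>a b. a \<in> C \<Longrightarrow> b \<in> C \<Longrightarrow> j = a \<squnion> b \<Longrightarrow> j = a \<or> j = b"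
      by (auto simp: join_irreducibles_def)
    have "{z \<in> C. (j \<sqinter> z, j) \<in> Id_on C} = P" by (auto simp: P ple_def)
    then have "con_filter (Id_on C) P"
      using con_filter_principal[OF Id_on_Con, of j] by simp
    then show "P \<in> prime_filters A"
    proof (rule prime_filterI[OF Id_on_Con])
      show "\<zero> \<notin> P" using j(1) by (auto simp: P le_zero)
      fix x y assume xy: "x \<in> C" "y \<in> C" "x \<squnion> y \<in> P"
      then have "j = j \<sqinter> x \<squnion> j \<sqinter> y" by (simp add: P ple_def distrib)
      then have "j = j \<sqinter> x \<or> j = j \<sqinter> y" by (rule j(2)[rotated 2]) (use xy in auto)
      then show "x \<in> P \<or> y \<in> P" using xy by (auto simp: P ple_def)
    qed
  next
    fix P assume P: "P \<in> prime_filters A"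
    note p = prime_filterD[OF P]
    obtain j where j: "j \<in> P" and jP: "\<And>x. x \<in> C \<Longrightarrow> x \<in> P \<longleftrightarrow> j \<sqsubseteq> x"
      using prime_filter_least[OF P] by blast
    have jC: "j \<in> C" using j p(1) by blast
    have "j = a \<or> j = b" if ab: "a \<in> C" "b \<in> C" "j = a \<squnion> b" for a b
      using p(6)[OF ab(1,2)] j jP[OF ab(1)] jP[OF ab(2)] ab jC
      by (metis join_ge1 join_ge2 le_antisym)
    then have "j \<in> join_irreducibles A"
      using j p(3) jC by (auto simp: join_irreducibles_def)
    moreover have "P = {x \<in> C. j \<sqsubseteq> x}" using jP p(1) by blast
    ultimately show "P \<in> (\<lambda>j. {x \<in> C. j \<sqsubseteq> x}) ` join_irreducibles A" by blast
  qed
qed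

lemma principal_filter_subset_iff:
  assumes "i \<in> C" "j \<in> C"
  shows "{x \<in> C. i \<sqsubseteq> x} \<subseteq> {x \<in> C. j \<sqsubseteq> x} \<longleftrightarrow> j \<sqsubseteq> i"
  using le_refl[OF assms(1)] le_trans[of j i] assms by auto

end

lemma piso_Up:
  assumes f: "bij_betw f P Q"
    and le: "\<And>x y. x \<in> P \<Longrightarrow> y \<in> P \<Longrightarrow> le' (f x) (f y) \<longleftrightarrow> le x y"
  shows "piso (Up P le) (Up Q le')"
  unfolding piso_def
proof (rule bexI)
  have inj: "inj_on f P" and Q: "Q = f ` P" using f by (auto simp: bij_betw_def)
  have "f ` U \<inter> f ` V = f ` (U \<inter> V)" if "U \<subseteq> P" "V \<subseteq> P" for U V
    using inj_on_image_Int[OF inj that] by simp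
  moreover have "f ` (P - {p \<in> P. \<exists>u\<in>U. le p u}) = Q - {q \<in> Q. \<exists>u\<in>f ` U. le' q u}"
    if U: "U \<subseteq> P" for U
  proof -
    have "{q \<in> Q. \<exists>u\<in>f ` U. le' q u} = f ` {p \<in> P. \<exists>u\<in>U. le p u}"
      using le subsetD[OF U] by (auto simp: Q intro!: imageI)
    moreover have "f ` (P - {p \<in> P. \<exists>u\<in>U. le p u}) = f ` P - f ` {p \<in> P. \<exists>u\<in>U. le p u}"
      by (rule inj_on_image_set_diff[OF inj]) auto
    ultimately show ?thesis by (simp add: Q)
  qed
  ultimately show "(`) f \<in> phom (Up P le) (Up Q le')"
    using le unfolding phom_def Up_def by (auto simp: Q)
  show "bij_betw ((`) f) (pcarrier (Up P le)) (pcarrier (Up Q le'))"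
  proof (rule bij_betw_imageI)
    show "inj_on ((`) f) (pcarrier (Up P le))"
      by (rule inj_onI) (auto simp: Up_def inj_on_image_eq_iff[OF inj])
    have "\<exists>U\<in>pcarrier (Up P le). V = f ` U" if "V \<in> pcarrier (Up Q le')" for V
      using that le by (intro bexI[of _ "{x \<in> P. f x \<in> V}"]) (auto simp: Up_def Q)
    moreover have "f ` U \<in> pcarrier (Up Q le')" if "U \<in> pcarrier (Up P le)" for U
      using that le by (auto simp: Up_def Q)
    ultimately show "(`) f ` pcarrier (Up P le) = pcarrier (Up Q le')" by blast
  qed
qed

context finite_p_alg
begin

theorem piso_Up_prime_filters_Cm:
  "piso (Up (prime_filters A) (\<subseteq>)) (Up (Cm A) (le_Cm A))"
  by (rule piso_Up[OF bij_prime_con]) (simp add: le_Cm_prime_con)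

theorem piso_Up_Cm_join_irreducibles:
  "piso (Up (Cm A) (le_Cm A)) (Up (join_irreducibles A) (\<lambda>x y. y \<sqsubseteq> x))"
proof -
  define g where "g j = prime_con {x \<in> C. j \<sqsubseteq> x}" for j
  have bij: "bij_betw g (join_irreducibles A) (Cm A)"
    using bij_betw_trans[OF bij_principal_filter bij_prime_con]
    unfolding comp_def g_def[abs_def] .
  have g: "le_Cm A (g i) (g j) \<longleftrightarrow> j \<sqsubseteq> i"
    if ij: "i \<in> join_irreducibles A" "j \<in> join_irreducibles A" for i j
  proof -
    have "{x \<in> C. i \<sqsubseteq> x} \<in> prime_filters A" "{x \<in> C. j \<sqsubseteq> x} \<in> prime_filters A"
      using ij bij_betwE[OF bij_principal_filter] by auto
    then show ?thesis
      using ij by (simp add: g_def le_Cm_prime_con principal_filter_subset_iff join_irreducibles_def)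
  qed
  show ?thesis
  proof (rule piso_Up[OF bij_betw_inv_into[OF bij]])
    fix \<mu> \<nu> assume "\<mu> \<in> Cm A" "\<nu> \<in> Cm A"
    then obtain i j where ij: "i \<in> join_irreducibles A" "j \<in> join_irreducibles A"
      and \<mu>\<nu>: "\<mu> = g i" "\<nu> = g j"
      unfolding bij_betw_imp_surj_on[OF bij, symmetric] by auto
    have inv: "inv_into (join_irreducibles A) g \<mu> = i" "inv_into (join_irreducibles A) g \<nu> = j"
      unfolding \<mu>\<nu> by (rule inv_into_f_f[OF bij_betw_imp_inj_on[OF bij]], rule ij)+
    show "inv_into (join_irreducibles A) g \<nu> \<sqsubseteq> inv_into (join_irreducibles A) g \<mu> \<longleftrightarrow>
        le_Cm A \<mu> \<nu>"
      unfolding inv unfolding \<mu>\<nu> g[OF ij] ..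
  qed
qed

end

section \<open>Kernels of homomorphisms into the generating algebras\<close>

context p_alg
begin

lemma prime_filter_vimage_one:
  assumes h: "h \<in> phom A (Bbar s)"
  shows "{a \<in> C. h a = None} \<in> prime_filters A"
proof (rule prime_filterI[OF Id_on_Con])
  have join: "pjoin (Bbar s) x y = None \<longleftrightarrow> x = None \<or> y = None" for x y
    by (cases x; cases y) simp_all
  have hs: "h \<zero> = Some {}" "h \<one> = None" "\<And>x y. x \<in> C \<Longrightarrow> y \<in> C \<Longrightarrow> h (x \<sqinter> y) = pmeet (Bbar s) (h x) (h y)"
    "\<And>x y. x \<in> C \<Longrightarrow> y \<in> C \<Longrightarrow> h (x \<squnion> y) = pjoin (Bbar s) (h x) (h y)"
    using h by (auto simp: phom_def)
  show "con_filter (Id_on C) {a \<in> C. h a = None}"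
    unfolding con_filter_def
  proof (intro conjI ballI impI)
    fix x y assume "x \<in> {a \<in> C. h a = None}" "y \<in> C" "(x \<sqinter> y, x) \<in> Id_on C"
    then show "y \<in> {a \<in> C. h a = None}" using hs(3)[of x y] by auto
  qed (auto simp: hs)
  show "\<zero> \<notin> {a \<in> C. h a = None}" by (simp add: hs)
  show "x \<squnion> y \<in> {a \<in> C. h a = None} \<Longrightarrow> x \<in> {a \<in> C. h a = None} \<or> y \<in> {a \<in> C. h a = None}"
    if "x \<in> C" "y \<in> C" for x y
    using that by (simp add: hs join)
qed

text \<open>If \<open>h a = h b\<close>, the witness for the congruence is \<open>agree a b\<close>, which \<open>h\<close> maps to the top. In the
  other direction, a witness \<open>p\<close> has the top as its image, so \<open>h a\<close> and \<open>h b\<close> have the same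
  pseudocomplement; on the elements of \<open>Bbar s\<close> other than the new top, pseudocomplementation is
  injective.\<close>

lemma kernel_eq_prime_con:
  assumes h: "h \<in> phom A (Bbar s)"
  shows "{(a, b). a \<in> C \<and> b \<in> C \<and> h a = h b} = prime_con {a \<in> C. h a = None}"
proof -
  have hC: "h x = None \<or> (\<exists>c. c \<subseteq> {..<s} \<and> h x = Some c)" if "x \<in> C" for x
    using h that by (auto simp: phom_def)
  have hs: "\<And>x. x \<in> C \<Longrightarrow> h (star x) = pstar (Bbar s) (h x)"
    "\<And>x y. x \<in> C \<Longrightarrow> y \<in> C \<Longrightarrow> h (x \<sqinter> y) = pmeet (Bbar s) (h x) (h y)"
    using h by (auto simp: phom_def)
  have "(a, b) \<in> prime_con {a \<in> C. h a = None}" if ab: "a \<in> C" "b \<in> C" "h a = h b" for a b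
  proof (rule prime_conI)
    have "h (agree a b) = None"
      using hC[OF ab(1)] ab by (auto simp: agree_def hs)
    then show "agree a b \<in> {a \<in> C. h a = None}" using ab by simp
  qed (use ab in auto)
  moreover have "h a = h b" if ab: "(a, b) \<in> prime_con {a \<in> C. h a = None}" for a b
  proof -
    have C: "a \<in> C" "b \<in> C" and one: "h a = None \<longleftrightarrow> h b = None"
      using ab by (auto simp: prime_con_def)
    obtain p where p: "p \<in> C" "h p = None" "p \<sqinter> star a = p \<sqinter> star b"
      using ab by (auto simp: prime_con_def)
    have "h (p \<sqinter> star a) = h (p \<sqinter> star b)" using p(3) by simp
    then have "pstar (Bbar s) (h a) = pstar (Bbar s) (h b)" using p(1,2) C by (simp add: hs)
    moreover have "c = d" if "c \<subseteq> {..<s}" "d \<subseteq> {..<s}" "pstar (Bbar s) (Some c) = pstar (Bbar s) (Some d)"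
      for c d
      using that by (simp split: if_splits) blast
    ultimately show ?thesis using one hC[OF C(1)] hC[OF C(2)] by (metis option.discI)
  qed
  moreover have "prime_con {a \<in> C. h a = None} \<subseteq> C \<times> C" by (auto simp: prime_con_def)
  ultimately show ?thesis by (auto simp del: Bbar_simps)
qed

end


section \<open>Kripke semantics of terms\<close>

text \<open>The Kripke model has a root below one maximal node for each member of \<open>\<T>\<close>. At a maximal node
  terms are evaluated classically (\<open>holds\<close>). A pseudocomplement is forced at the root if its argument
  fails at all maximal nodes; if \<open>\<T>\<close> is nonempty and \<open>L \<subseteq> \<Inter>\<T>\<close>, the argument then fails at the
  root as well, by persistence.\<close>

fun holds :: "nat set \<Rightarrow> pterm \<Rightarrow> bool" where
  "holds T (Var i) \<longleftrightarrow> i \<in> T"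
| "holds T Zero \<longleftrightarrow> False"
| "holds T One \<longleftrightarrow> True"
| "holds T (Star t) \<longleftrightarrow> \<not> holds T t"
| "holds T (Meet t u) \<longleftrightarrow> holds T t \<and> holds T u"
| "holds T (Join t u) \<longleftrightarrow> holds T t \<or> holds T u"

fun forces :: "nat set set \<Rightarrow> nat set \<Rightarrow> pterm \<Rightarrow> bool" where
  "forces \<T> L (Var i) \<longleftrightarrow> i \<in> L"
| "forces \<T> L Zero \<longleftrightarrow> False"
| "forces \<T> L One \<longleftrightarrow> True"
| "forces \<T> L (Star t) \<longleftrightarrow> (\<forall>T\<in>\<T>. \<not> holds T t)"
| "forces \<T> L (Meet t u) \<longleftrightarrow> forces \<T> L t \<and> forces \<T> L u"
| "forces \<T> L (Join t u) \<longleftrightarrow> forces \<T> L t \<or> forces \<T> L u"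

lemma forces_mono:
  assumes "\<S> \<subseteq> \<T>" "L \<subseteq> K" "forces \<T> L t"
  shows "forces \<S> K t"
  using assms by (induction t) auto

lemma forces_imp_holds:
  assumes "L \<subseteq> \<Inter>\<T>" "T \<in> \<T>" "forces \<T> L t"
  shows "holds T t"
  using assms by (induction t) auto

text \<open>The new top of \<open>Bbar s\<close> is the upset of all nodes, and \<open>Some X\<close> is the upset of the maximal nodes
  with index in \<open>X\<close>. The valuation \<open>v\<close> sends each variable to the set of nodes where it holds, so the
  value of a term is the set of nodes where the term is true. The case \<open>s = 0\<close> is excluded because
  without maximal nodes \<open>Star One\<close> would be forced.\<close>

lemma peval_Bbar:
  assumes s: "0 < s" and L: "\<And>j. j < s \<Longrightarrow> L \<subseteq> T j"
    and v: "\<And>i. v i = (if i \<in> L then None else Some {j. j < s \<and> i \<in> T j})"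
  shows "peval (Bbar s) v t =
    (if forces (T ` {..<s}) L t then None else Some {j. j < s \<and> holds (T j) t})"
proof -
  have *: "holds (T j) t" if "forces (T ` {..<s}) L t" "j < s" for j t
    using forces_imp_holds[OF _ _ that(1)] L that(2) by auto
  show ?thesis
  proof (induction t)
    case (Star t)
    then show ?case using s *[of t] by auto
  next
    case (Meet t u)
    then show ?case using *[of t] *[of u] by auto
  qed (use v in auto)
qed

definition minterm :: "nat list \<Rightarrow> nat set \<Rightarrow> pterm" where
  "minterm xs S = foldr (\<lambda>i. Meet (if i \<in> S then Var i else Star (Var i))) xs One"

lemma holds_minterm: "holds T (minterm xs S) \<longleftrightarrow> (\<forall>i\<in>set xs. i \<in> T \<longleftrightarrow> i \<in> S)"
  by (induction xs) (auto simp: minterm_def)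

lemma pvars_minterm: "pvars (minterm xs S) = set xs"
  by (induction xs) (auto simp: minterm_def)

text \<open>A variable in \<open>L - K\<close> is forced only on the left. For \<open>S \<in> \<S> - \<T>\<close>, the pseudocomplement of the
  minterm of \<open>S\<close> is forced only on the left, since \<open>S\<close> is the only subset of \<open>{1..k}\<close> at which that
  minterm holds.\<close>

lemma forces_le_iff:
  assumes "\<T> \<subseteq> Pow {1..k}" "\<S> \<subseteq> Pow {1..k}" "L \<subseteq> {1..k}"
  shows "(\<forall>t. pvars t \<subseteq> {1..k} \<longrightarrow> forces \<T> L t \<longrightarrow> forces \<S> K t) \<longleftrightarrow> \<S> \<subseteq> \<T> \<and> L \<subseteq> K"
proof (intro iffI conjI subsetI)
  assume *: "\<forall>t. pvars t \<subseteq> {1..k} \<longrightarrow> forces \<T> L t \<longrightarrow> forces \<S> K t"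
  show "i \<in> K" if "i \<in> L" for i
    using *[rule_format, of "Var i"] that assms(3) by auto
  show "S \<in> \<T>" if S: "S \<in> \<S>" for S
  proof (rule ccontr)
    assume "S \<notin> \<T>"
    let ?t = "minterm [1..<Suc k] S"
    have eq: "holds T ?t \<longleftrightarrow> T = S" if "T \<subseteq> {1..k}" for T
    proof -
      have "holds T ?t \<longleftrightarrow> (\<forall>i\<in>{1..k}. i \<in> T \<longleftrightarrow> i \<in> S)"
        unfolding holds_minterm by (intro ball_cong) auto
      also have "\<dots> \<longleftrightarrow> T = S"
      proof -
        have "S \<subseteq> {1..k}" using S assms(2) by auto
        then show ?thesis using that by blast
      qed
      finally show "holds T ?t \<longleftrightarrow> T = S" .
    qed
    have "\<not> holds T ?t" if "T \<in> \<T>" for T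
      using eq[of T] that \<open>S \<notin> \<T>\<close> assms(1) by auto
    moreover have "holds S ?t" using eq[of S] S assms(2) by auto
    moreover have "pvars (Star ?t) \<subseteq> {1..k}" by (auto simp: pvars_minterm)
    ultimately show False using *[rule_format, of "Star ?t"] S by auto
  qed
qed (use forces_mono in blast)


section \<open>Free algebras\<close>

text \<open>The class of a term is determined by the function that the term induces on the finitely many
  valuations of \<open>{1..k}\<close> in the finite algebra \<open>Bbar n\<close>.\<close>

lemma finite_free: "finite (pcarrier (free n k))"
proof -
  define B where "B = pcarrier (Bbar n)"
  define V where "V = {1..k} \<rightarrow>\<^sub>E B"
  \<comment> \<open>Valuations are total functions; \<open>None\<close> is an arbitrary value in \<open>B\<close> outside \<open>{1..k}\<close>.\<close>
  define ext where "ext v i = (if i \<in> {1..k} then v i else None)" for v :: "nat \<Rightarrow> nat set option" and i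
  define G where "G t = restrict (\<lambda>v. peval (Bbar n) (ext v) t) V" for t
  define S where "S = {t. pvars t \<subseteq> {1..k}}"
  have ext: "ext v \<in> UNIV \<rightarrow> B" if "v \<in> V" for v
    using that by (auto simp: ext_def V_def B_def PiE_iff)
  have "G t \<in> V \<rightarrow>\<^sub>E B" for t
    using peval_closed[OF p_algebra_Bbar ext[unfolded B_def]] by (auto simp: G_def B_def)
  moreover have "finite (V \<rightarrow>\<^sub>E B)"
    unfolding V_def by (intro finite_PiE) (auto simp: B_def)
  ultimately have fin: "finite (G ` S)" by (meson finite_subset image_subsetI)
  have eq: "term_equiv n k `` {t} = term_equiv n k `` {u}"
    if tu: "t \<in> S" "u \<in> S" "G t = G u" for t u
  proof -
    have "peval (Bbar n) v t = peval (Bbar n) v u" if v: "v \<in> UNIV \<rightarrow> B" for v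
    proof -
      have r: "restrict v {1..k} \<in> V" using v by (auto simp: V_def)
      have *: "peval (Bbar n) v w = G w (restrict v {1..k})" if "w \<in> S" for w
        using that r by (auto simp: G_def S_def ext_def intro!: peval_cong)
      show ?thesis using *[OF tu(1)] *[OF tu(2)] tu(3) by simp
    qed
    then have "satisfies (Bbar n) t u" by (simp add: satisfies_def B_def)
    then show ?thesis using tu by (simp add: term_equiv_class_eq S_def)
  qed
  have "pcarrier (free n k) \<subseteq> (\<lambda>g. term_equiv n k `` {inv_into S G g}) ` G ` S"
  proof
    fix X assume "X \<in> pcarrier (free n k)"
    then obtain t where t: "t \<in> S" "X = term_equiv n k `` {t}" by (auto simp: free_carrier S_def)
    have "X = term_equiv n k `` {inv_into S G (G t)}"
      unfolding t(2) using t(1) by (intro eq) (auto intro: inv_into_into simp: f_inv_into_f)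
    then show "X \<in> (\<lambda>g. term_equiv n k `` {inv_into S G g}) ` G ` S" using t(1) by blast
  qed
  then show ?thesis using fin finite_subset finite_imageI by blast
qed

interpretation free: finite_p_alg "free n k" for n k
  by unfold_locales (rule p_algebra_free finite_free)+

lemma class_in_free: "pvars t \<subseteq> {1..k} \<Longrightarrow> term_equiv n k `` {t} \<in> pcarrier (free n k)"
  unfolding free_carrier by blast

lemma phom_free_class:
  assumes h: "h \<in> phom (free n k) A" and v: "\<And>i. i \<in> {1..k} \<Longrightarrow> h (gen n k i) = v i"
    and t: "pvars t \<subseteq> {1..k}"
  shows "h (term_equiv n k `` {t}) = peval A v t"
  using t
proof (induction t)
  case (Var i)
  then show ?case using v by (simp add: gen_def)
qed (use h in \<open>simp_all add: phom_def free_const class_in_free flip: free_star free_binary\<close>)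

lemma free_ext:
  assumes "Pa n A" "g \<in> {1..k} \<rightarrow> pcarrier A"
  shows "free_ext n k A g \<in> phom (free n k) A"
    "pvars t \<subseteq> {1..k} \<Longrightarrow> free_ext n k A g (term_equiv n k `` {t}) = peval A g t"
  using theI'[OF free_universal[OF assms]] phom_free_class[of _ n k A g t]
  unfolding free_ext_def by auto

definition forced :: "nat \<Rightarrow> nat \<Rightarrow> nat set set \<Rightarrow> nat set \<Rightarrow> pterm set set" where
  "forced n k \<T> L = {term_equiv n k `` {t} | t. pvars t \<subseteq> {1..k} \<and> forces \<T> L t}"

lemma mu_eq_prime_con:
  assumes adm: "admissible n k Ts L"
  shows "mu n k Ts L = p_alg.prime_con (free n k) (forced n k (set Ts) L)"
    "forced n k (set Ts) L \<in> prime_filters (free n k)"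
    "pvars t \<subseteq> {1..k} \<Longrightarrow> term_equiv n k `` {t} \<in> forced n k (set Ts) L \<longleftrightarrow> forces (set Ts) L t"
proof -
  let ?s = "length Ts"
  define h where "h = free_ext n k (Bbar ?s) (g_map Ts L)"
  have s: "0 < ?s" "?s \<le> n" and L: "L \<subseteq> \<Inter>(set Ts)" using adm by (auto simp: admissible_def)
  have hom: "h \<in> phom (free n k) (Bbar ?s)"
    unfolding h_def by (rule free_ext(1)[OF Pa_Bbar[OF s(2)] g_map_closed])
  have Ts: "(!) Ts ` {..<?s} = set Ts" by (auto simp: set_conv_nth)
  have None_iff: "h (term_equiv n k `` {t}) = None \<longleftrightarrow> forces (set Ts) L t" if "pvars t \<subseteq> {1..k}" for t
  proof -
    have "h (term_equiv n k `` {t}) = peval (Bbar ?s) (g_map Ts L) t"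
      unfolding h_def by (rule free_ext(2)[OF Pa_Bbar[OF s(2)] g_map_closed that])
    also have "\<dots> = (if forces ((!) Ts ` {..<?s}) L t then None
        else Some {j. j < ?s \<and> holds (Ts ! j) t})"
      using s(1) L by (intro peval_Bbar) (auto simp: g_map_def)
    finally show ?thesis unfolding Ts by simp
  qed
  have F: "{a \<in> pcarrier (free n k). h a = None} = forced n k (set Ts) L"
    using None_iff by (auto simp: forced_def free_carrier)
  show "mu n k Ts L = p_alg.prime_con (free n k) (forced n k (set Ts) L)"
    using free.kernel_eq_prime_con[OF hom, unfolded F] by (simp only: mu_def h_def)
  show "forced n k (set Ts) L \<in> prime_filters (free n k)"
    using free.prime_filter_vimage_one[OF hom] by (simp only: F)
  show "term_equiv n k `` {t} \<in> forced n k (set Ts) L \<longleftrightarrow> forces (set Ts) L t"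
    if "pvars t \<subseteq> {1..k}"
    using None_iff[OF that] class_in_free[OF that] unfolding F[symmetric] by simp
qed

lemma le_Cm_mu_iff:
  assumes T: "admissible n k Ts L" and S: "admissible n k Ss K"
  shows "le_Cm (free n k) (mu n k Ts L) (mu n k Ss K) \<longleftrightarrow> set Ss \<subseteq> set Ts \<and> L \<subseteq> K"
proof -
  have "le_Cm (free n k) (mu n k Ts L) (mu n k Ss K) \<longleftrightarrow>
      forced n k (set Ts) L \<subseteq> forced n k (set Ss) K"
    using mu_eq_prime_con[OF T] mu_eq_prime_con[OF S] by (simp add: free.le_Cm_prime_con)
  also have "\<dots> \<longleftrightarrow>
      (\<forall>t. pvars t \<subseteq> {1..k} \<longrightarrow> forces (set Ts) L t \<longrightarrow> forces (set Ss) K t)"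
    using mu_eq_prime_con(3)[OF S] unfolding forced_def[of n k "set Ts"] by blast
  also have "\<dots> \<longleftrightarrow> set Ss \<subseteq> set Ts \<and> L \<subseteq> K"
  proof (rule forces_le_iff)
    show "set Ts \<subseteq> Pow {1..k}" "set Ss \<subseteq> Pow {1..k}"
      using T S by (auto simp: admissible_def)
    have "Ts \<noteq> []" using T by (auto simp: admissible_def)
    then have "hd Ts \<in> set Ts" by simp
    then show "L \<subseteq> {1..k}" using T unfolding admissible_def by blast
  qed
  finally show ?thesis .
qed

text \<open>Each prime filter of \<open>Bbar n\<close> other than the one that consists of the top alone is given by a
  coordinate \<open>i\<close>. Collapsing \<open>Bbar n\<close> onto its two extreme elements along this coordinate moves it
  to the preimage of the top.\<close>

lemma coordinate_hom:
  assumes "i < n"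
  shows "(\<lambda>x. case x of None \<Rightarrow> None | Some c \<Rightarrow> if i \<in> c then None else Some {})
    \<in> phom (Bbar n) (Bbar n)"
  unfolding phom_def mem_Collect_eq Pi_iff Bbar_ball
  using assms by (auto simp: Some_in_Bbar simp del: Bbar_simps(1))

lemma valuation_separates:
  assumes "\<not> satisfies (Bbar n) (Meet t u) t"
  obtains v where "v \<in> UNIV \<rightarrow> pcarrier (Bbar n)" "peval (Bbar n) v t = None" "peval (Bbar n) v u \<noteq> None"
proof -
  obtain v where v: "v \<in> UNIV \<rightarrow> pcarrier (Bbar n)"
    and ne: "pmeet (Bbar n) (peval (Bbar n) v t) (peval (Bbar n) v u) \<noteq> peval (Bbar n) v t"
    using assms by (auto simp: satisfies_def simp del: Bbar_simps)
  have cl: "peval (Bbar n) v w \<in> pcarrier (Bbar n)" for w by (rule peval_closed[OF p_algebra_Bbar v])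
  show thesis
  proof (cases "peval (Bbar n) v t")
    case None
    then show ?thesis using that[OF v] ne by auto
  next
    case (Some c)
    obtain d where d: "peval (Bbar n) v u = Some d" using ne Some by (cases "peval (Bbar n) v u") auto
    obtain i where i: "i \<in> c" "i \<notin> d" using ne Some d by auto
    have "i < n" using cl[of t] Some i(1) by auto
    let ?q = "\<lambda>x. case x of None \<Rightarrow> None | Some c \<Rightarrow> if i \<in> c then None else Some {}"
    note q = coordinate_hom[OF \<open>i < n\<close>]
    have "?q \<circ> v \<in> UNIV \<rightarrow> pcarrier (Bbar n)"
      using v q by (auto simp: phom_def simp del: Bbar_simps)
    moreover have "peval (Bbar n) (?q \<circ> v) t = None" "peval (Bbar n) (?q \<circ> v) u \<noteq> None"
      unfolding peval_hom[OF q p_algebra_Bbar v, symmetric] using Some d i by simp_all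
    ultimately show ?thesis by (rule that)
  qed
qed

text \<open>Each coordinate \<open>j\<close> gives the maximal node \<open>T j\<close> at which the variables with \<open>j\<close> in their value
  hold; coordinates with equal nodes are merged, as forcing depends only on the set of nodes. For
  \<open>n = 0\<close> there would be no node, which is why \<open>n\<close> must be positive.\<close>

lemma admissible_of_valuation:
  assumes n: "1 \<le> n" and v: "v \<in> UNIV \<rightarrow> pcarrier (Bbar n)"
  obtains Ts L where "admissible n k Ts L"
    "\<And>t. pvars t \<subseteq> {1..k} \<Longrightarrow> peval (Bbar n) v t = None \<longleftrightarrow> forces (set Ts) L t"
proof -
  define L where "L = {i \<in> {1..k}. v i = None}"
  define T where "T j = {i \<in> {1..k}. i \<in> L \<or> j \<in> the (v i)}" for j
  obtain Ts where Ts: "set Ts = T ` {..<n}" "distinct Ts"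
    using finite_distinct_list[of "T ` {..<n}"] by auto
  have "length Ts \<le> n"
    using distinct_card[OF Ts(2)] card_image_le[of "{..<n}" T] by (simp add: Ts(1))
  moreover have "T 0 \<in> set Ts" using Ts(1) n by auto
  then have "Ts \<noteq> []" by auto
  moreover have "L \<subseteq> T j" "T j \<subseteq> {1..k}" for j by (auto simp: T_def L_def)
  ultimately have "admissible n k Ts L" using Ts by (auto simp: admissible_def)
  moreover have "peval (Bbar n) v t = None \<longleftrightarrow> forces (set Ts) L t" if t: "pvars t \<subseteq> {1..k}" for t
  proof -
    let ?v = "\<lambda>i. if i \<in> L then None else Some {j. j < n \<and> i \<in> T j}"
    have "v i = ?v i" if "i \<in> {1..k}" for i
    proof (cases "v i")
      case (Some c)
      then have "c \<subseteq> {..<n}" using v by (metis Pi_iff Some_in_Bbar(1) UNIV_I)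
      then show ?thesis using Some that by (auto simp: L_def T_def)
    qed (use that in \<open>simp add: L_def\<close>)
    then have "peval (Bbar n) v t = peval (Bbar n) ?v t"
      using t by (intro peval_cong) blast
    also have "\<dots> = (if forces (T ` {..<n}) L t then None else Some {j. j < n \<and> holds (T j) t})"
      using n \<open>\<And>j. L \<subseteq> T j\<close> by (intro peval_Bbar) auto
    finally show ?thesis by (simp add: Ts(1))
  qed
  ultimately show thesis by (rule that)
qed

text \<open>A prime filter is the only one that contains its least element \<open>j\<close> and omits the greatest
  element \<open>m\<close> of its complement, so it is enough to find a forced set with these two properties.\<close>

lemma prime_filter_free_forced:
  assumes n: "1 \<le> n" and P: "P \<in> prime_filters (free n k)"
  obtains Ts L where "admissible n k Ts L" "P = forced n k (set Ts) L"
proof -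
  obtain j where j: "j \<in> P" and Pj: "\<And>x. x \<in> pcarrier (free n k) \<Longrightarrow> x \<in> P \<longleftrightarrow> ple (free n k) j x"
    using free.prime_filter_least[OF P] by blast
  obtain m where m: "m \<in> pcarrier (free n k)"
    and Pm: "\<And>x. x \<in> pcarrier (free n k) \<Longrightarrow> x \<in> P \<longleftrightarrow> \<not> ple (free n k) x m"
    using free.prime_filter_complement_greatest[OF P] by blast
  have jC: "j \<in> pcarrier (free n k)" using free.prime_filterD(1)[OF P] j by blast
  obtain t u where t: "pvars t \<subseteq> {1..k}" "j = term_equiv n k `` {t}"
    and u: "pvars u \<subseteq> {1..k}" "m = term_equiv n k `` {u}"
    using jC m by (auto simp: free_carrier)
  have "\<not> satisfies (Bbar n) (Meet t u) t"
    using Pm[OF jC] j t u by (simp add: ple_def free_binary term_equiv_class_eq)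
  then obtain v where v: "v \<in> UNIV \<rightarrow> pcarrier (Bbar n)"
    "peval (Bbar n) v t = None" "peval (Bbar n) v u \<noteq> None"
    by (rule valuation_separates)
  obtain Ts L where adm: "admissible n k Ts L"
    and TL: "\<And>t. pvars t \<subseteq> {1..k} \<Longrightarrow> peval (Bbar n) v t = None \<longleftrightarrow> forces (set Ts) L t"
    using admissible_of_valuation[OF n v(1)] by blast
  note Q = mu_eq_prime_con(2,3)[OF adm]
  have jQ: "j \<in> forced n k (set Ts) L" and mQ: "m \<notin> forced n k (set Ts) L"
    using Q(2)[OF t(1)] Q(2)[OF u(1)] TL[OF t(1)] TL[OF u(1)] v t(2) u(2) by auto
  have "P = forced n k (set Ts) L"
  proof (intro equalityI subsetI)
    fix x assume "x \<in> P"
    moreover have "x \<in> pcarrier (free n k)" using free.prime_filterD(1)[OF P] \<open>x \<in> P\<close> by blast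
    ultimately show "x \<in> forced n k (set Ts) L"
      using free.prime_filterD(4)[OF Q(1) jQ] Pj by blast
  next
    fix x assume x: "x \<in> forced n k (set Ts) L"
    moreover have "x \<in> pcarrier (free n k)" using free.prime_filterD(1)[OF Q(1)] x by blast
    ultimately show "x \<in> P"
      using free.prime_filterD(4)[OF Q(1) x _ m] mQ Pm by blast
  qed
  then show thesis using adm that by blast
qed

lemma Cm_free:
  assumes "1 \<le> n"
  shows "Cm (free n k) = {mu n k Ts L | Ts L. admissible n k Ts L}"
proof (intro equalityI subsetI)
  fix \<mu> assume "\<mu> \<in> Cm (free n k)"
  then obtain P where P: "P \<in> prime_filters (free n k)" "\<mu> = p_alg.prime_con (free n k) P"
    unfolding free.Cm_eq by blast
  show "\<mu> \<in> {mu n k Ts L | Ts L. admissible n k Ts L}"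
    by (rule prime_filter_free_forced[OF assms P(1)]) (use P(2) mu_eq_prime_con(1) in blast)
next
  fix \<mu> assume "\<mu> \<in> {mu n k Ts L | Ts L. admissible n k Ts L}"
  then show "\<mu> \<in> Cm (free n k)"
    unfolding free.Cm_eq using mu_eq_prime_con(1,2) by blast
qed

theorem theorem5p7:
  fixes n k :: nat
  shows
    "(1 \<le> n \<longrightarrow> Cm (free n k) = {mu n k Ts L | Ts L. admissible n k Ts L}) \<and>
     (\<forall>Ts L Ss K. admissible n k Ts L \<longrightarrow> admissible n k Ss K \<longrightarrow>
        (le_Cm (free n k) (mu n k Ts L) (mu n k Ss K) \<longleftrightarrow> set Ss \<subseteq> set Ts \<and> L \<subseteq> K)) \<and>
     piso (free n k) (Up (prime_filters (free n k)) (\<subseteq>)) \<and>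
     piso (Up (prime_filters (free n k)) (\<subseteq>)) (Up (Cm (free n k)) (le_Cm (free n k))) \<and>
     piso (Up (Cm (free n k)) (le_Cm (free n k)))
       (Up (join_irreducibles (free n k)) (\<lambda>x y. ple (free n k) y x))"
  by (intro conjI impI allI Cm_free le_Cm_mu_iff free.piso_Up_prime_filters
      free.piso_Up_prime_filters_Cm free.piso_Up_Cm_join_irreducibles)

end
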